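(* Let $(\mathcal X,d,\mu)$ be a doubling metric measure space (see context). Suppose that $\mathcal X$ supports a weak $(1,p)$-Poincaré inequality with $p\in(1,\infty)$. Then for all $q\in(0,\infty)$, the spaces $\dot N^1_{p,q}(\mathcal X)$ and $\dot M^1_{p,q}(\mathcal X)$ are trivial, that is, they contain only constant functions (up to equality almost everywhere).
   Context: Setting: $(\mathcal X,d)$ is a metric space and $\mu$ a regular Borel measure on $\mathcal X$ such that all balls have finite and positive measure, and $\mu$ is doubling: there exist constants $C_1>1$ and $n>0$ such that $\mu(B(x,\lambda r))\le C_1\lambda^n\mu(B(x,r))$ for all $x\in\mathcal X$, $r\in(0,\infty)$, $\lambda\in(1,\infty)$. Functions are real-valued; $⨍_E f\,d\mu=\frac1{\mu(E)}\int_E f\,d\mu$, $u_B=⨍_Bu\,d\mu$. Poincaré inequality: a nonnegative Borel function $g$ is a $p$-weak upper gradient of $u$ if $|u(x)-u(y)|\le\int_\gamma g\,ds$ for all $\gamma\in\Gamma_{\rm rect}\setminus\Gamma$, where $x,y$ are the endpoints of $\gamma$, $\Gamma_{\rm rect}$ is the collection of non-constant compact rectifiable curves in $\mathcal X$, and $\Gamma$ is some family of curves of $p$-modulus zero. $\mathcal X$ supports a weak $(1,p)$-Poincaré inequality, $p\in[1,\infty)$, if there exist $C>0$ and $\lambda>1$ such that for all functions $u$ that are integrable on balls, all $p$-weak upper gradients $g$ of $u$ and all balls $B$ of radius $r>0$, $⨍_B|u-u_B|\,d\mu\le Cr\{⨍_{\lambda B}g^p\,d\mu\}^{1/p}$.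 Fractional $s$-Hajłasz gradient ($s\in(0,\infty)$): for a measurable function $u$, a sequence $\vec g=\{g_k\}_{k\in\mathbb Z}$ of nonnegative measurable functions belongs to $\mathbb D^s(u)$ if there is $E\subset\mathcal X$ with $\mu(E)=0$ such that for all $k\in\mathbb Z$ and all $x,y\in\mathcal X\setminus E$ with $2^{-k-1}\le d(x,y)<2^{-k}$, $|u(x)-u(y)|\le[d(x,y)]^s[g_k(x)+g_k(y)]$. For $p\in(0,\infty)$, $q\in(0,\infty]$: $\dot N^s_{p,q}(\mathcal X)$ is the space of all measurable $u$ with $\inf_{\vec g\in\mathbb D^s(u)}\big\|\{\|g_k\|_{L^p(\mathcal X)}\}_{k\in\mathbb Z}\big\|_{\ell^q}<\infty$, and $\dot M^s_{p,q}(\mathcal X)$ is the space of all measurable $u$ with $\inf_{\vec g\in\mathbb D^s(u)}\big\|\,\|\{g_k\}_{k\in\mathbb Z}\|_{\ell^q}\big\|_{L^p(\mathcal X)}<\infty$. *)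

theory Defs
  imports "HOL-Analysis.Analysis"
begin

section \<open>Doubling metric measure spaces\<close>

text \<open>
  ``Regular Borel measure'' is read as Borel regular: Borel sets are measurable and every
  measurable set is contained in a Borel set of the same measure. The \<open>\<sigma>\<close>-algebra may be
  strictly larger than the Borel one (for instance its completion, i.e. the Caratheodory
  measurable sets of a Borel regular outer measure); ``measurable'' always refers to \<open>M\<close>,
  ``Borel'' to \<^const>\<open>borel\<close>.
\<close>

definition borel_regular :: "'a::metric_space measure \<Rightarrow> bool" where
  "borel_regular M \<longleftrightarrow>
     space M = UNIV \<and> sets borel \<subseteq> sets M \<and>
     (\<forall>A\<in>sets M. \<exists>B\<in>sets borel. A \<subseteq> B \<and> emeasure M B = emeasure M A)"

definition doubling :: "'a::metric_space measure \<Rightarrow> bool" where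
  "doubling M \<longleftrightarrow>
     (\<exists>C n. C > 1 \<and> n > 0 \<and>
       (\<forall>x r l. r > 0 \<longrightarrow> l > 1 \<longrightarrow>
         emeasure M (ball x (l * r)) \<le> ennreal (C * l powr n) * emeasure M (ball x r)))"

definition doubling_metric_measure_space :: "'a::metric_space measure \<Rightarrow> bool" where
  "doubling_metric_measure_space M \<longleftrightarrow>
     borel_regular M \<and>
     (\<forall>x r. r > 0 \<longrightarrow> 0 < emeasure M (ball x r) \<and> emeasure M (ball x r) < top) \<and>
     doubling M"


section \<open>Powers and norms\<close>

text \<open>Only used with positive exponents, hence \<open>top\<close> is mapped to \<open>top\<close>.\<close>

definition ennpowr :: "ennreal \<Rightarrow> real \<Rightarrow> ennreal" where
  "ennpowr x p = (if x = top then top else ennreal (enn2real x powr p))"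

definition Lp_norm :: "'a measure \<Rightarrow> real \<Rightarrow> ('a \<Rightarrow> ennreal) \<Rightarrow> ennreal" where
  "Lp_norm M p f = ennpowr (\<integral>\<^sup>+x. ennpowr (f x) p \<partial>M) (1 / p)"

definition lq_norm :: "ennreal \<Rightarrow> (int \<Rightarrow> ennreal) \<Rightarrow> ennreal" where
  "lq_norm q a =
     (if q = top then (SUP k. a k)
      else ennpowr (\<integral>\<^sup>+k. ennpowr (a k) (enn2real q) \<partial>count_space UNIV) (1 / enn2real q))"


section \<open>Rectifiable curves and line integrals\<close>

text \<open>
  Compact curves are parametrised by \<open>[0,1]\<close>, as in the library. \<open>curve_length \<gamma> t\<close> is the length
  of \<open>\<gamma>\<close> restricted to \<open>[0,t]\<close>.
\<close>

definition curve_length :: "(real \<Rightarrow> 'a::metric_space) \<Rightarrow> real \<Rightarrow> ennreal" where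
  "curve_length \<gamma> t =
     (SUP (n, \<tau>) \<in> {(n :: nat, \<tau> :: nat \<Rightarrow> real). mono \<tau> \<and> range \<tau> \<subseteq> {0..t}}.
        ennreal (\<Sum>i<n. dist (\<gamma> (\<tau> i)) (\<gamma> (\<tau> (Suc i)))))"

definition rect_curves :: "(real \<Rightarrow> 'a::metric_space) set" where
  "rect_curves =
     {\<gamma>. path \<gamma> \<and> curve_length \<gamma> 1 < top \<and> \<not> \<gamma> constant_on {0..1}}"

text \<open>
  The arc length parametrisation, defined on \<open>[0, length \<gamma>]\<close>: the value at \<open>s\<close> is \<open>\<gamma> t\<close> for any
  \<open>t\<close> with \<open>curve_length \<gamma> t = s\<close>. The choice of \<open>t\<close> is immaterial, since a curve is constant
  on intervals on which its length function is.
\<close>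

definition arclength_param :: "(real \<Rightarrow> 'a::metric_space) \<Rightarrow> real \<Rightarrow> 'a" where
  "arclength_param \<gamma> s = \<gamma> (inv_into {0..1} (\<lambda>t. enn2real (curve_length \<gamma> t)) s)"

definition line_integral :: "('a::metric_space \<Rightarrow> ennreal) \<Rightarrow> (real \<Rightarrow> 'a) \<Rightarrow> ennreal" where
  "line_integral g \<gamma> =
     (\<integral>\<^sup>+s\<in>{0..enn2real (curve_length \<gamma> 1)}. g (arclength_param \<gamma> s) \<partial>lborel)"


section \<open>Weak upper gradients and the Poincare inequality\<close>

definition modulus ::
    "'a::metric_space measure \<Rightarrow> real \<Rightarrow> (real \<Rightarrow> 'a) set \<Rightarrow> ennreal" where
  "modulus M p \<Gamma> =
     (INF \<rho> \<in> {\<rho> :: 'a \<Rightarrow> ennreal. \<rho> \<in> borel_measurable borel \<and>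
                 (\<forall>\<gamma>\<in>\<Gamma>. line_integral \<rho> \<gamma> \<ge> 1)}.
        \<integral>\<^sup>+x. ennpowr (\<rho> x) p \<partial>M)"

definition weak_upper_gradient ::
    "'a::metric_space measure \<Rightarrow> real \<Rightarrow> ('a \<Rightarrow> real) \<Rightarrow> ('a \<Rightarrow> real) \<Rightarrow> bool" where
  "weak_upper_gradient M p u g \<longleftrightarrow>
     g \<in> borel_measurable borel \<and> (\<forall>x. 0 \<le> g x) \<and>
     (\<exists>\<Gamma>. \<Gamma> \<subseteq> rect_curves \<and> modulus M p \<Gamma> = 0 \<and>
       (\<forall>\<gamma>\<in>rect_curves - \<Gamma>.
          ennreal \<bar>u (pathstart \<gamma>) - u (pathfinish \<gamma>)\<bar> \<le> line_integral (\<lambda>x. ennreal (g x)) \<gamma>))"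

definition average :: "'a measure \<Rightarrow> 'a set \<Rightarrow> ('a \<Rightarrow> real) \<Rightarrow> real" where
  "average M A u = (LINT x:A|M. u x) / measure M A"

definition integrable_on_balls :: "'a::metric_space measure \<Rightarrow> ('a \<Rightarrow> real) \<Rightarrow> bool" where
  "integrable_on_balls M u \<longleftrightarrow>
     u \<in> borel_measurable M \<and> (\<forall>x r. r > 0 \<longrightarrow> set_integrable M (ball x r) u)"

text \<open>The right-hand side of the inequality may be infinite.\<close>

definition weak_poincare :: "'a::metric_space measure \<Rightarrow> real \<Rightarrow> bool" where
  "weak_poincare M p \<longleftrightarrow>
     (\<exists>C l. C > 0 \<and> l > 1 \<and>
       (\<forall>u g. integrable_on_balls M u \<longrightarrow> weak_upper_gradient M p u g \<longrightarrow>
         (\<forall>x r. r > 0 \<longrightarrow>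
           ennreal (average M (ball x r) (\<lambda>y. \<bar>u y - average M (ball x r) u\<bar>))
             \<le> ennreal (C * r) *
               ennpowr ((\<integral>\<^sup>+y\<in>ball x (l * r). ennreal (g y powr p) \<partial>M)
                          / emeasure M (ball x (l * r)))
                 (1 / p))))"


section \<open>Fractional Hajlasz gradients and the function spaces\<close>

definition hajlasz_gradients ::
    "'a::metric_space measure \<Rightarrow> real \<Rightarrow> ('a \<Rightarrow> real) \<Rightarrow> (int \<Rightarrow> 'a \<Rightarrow> real) set" where
  "hajlasz_gradients M s u =
     {g. (\<forall>k. g k \<in> borel_measurable M \<and> (\<forall>x. 0 \<le> g k x)) \<and>
         (\<exists>E\<in>null_sets M. \<forall>k. \<forall>x\<in>- E. \<forall>y\<in>- E.
            2 powi (- k - 1) \<le> dist x y \<and> dist x y < 2 powi (- k) \<longrightarrow>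
            \<bar>u x - u y\<bar> \<le> dist x y powr s * (g k x + g k y))}"

definition N_space ::
    "'a::metric_space measure \<Rightarrow> real \<Rightarrow> real \<Rightarrow> ennreal \<Rightarrow> ('a \<Rightarrow> real) set" where
  "N_space M s p q =
     {u. u \<in> borel_measurable M \<and>
         (INF g\<in>hajlasz_gradients M s u.
            lq_norm q (\<lambda>k. Lp_norm M p (\<lambda>x. ennreal (g k x)))) < top}"

definition M_space ::
    "'a::metric_space measure \<Rightarrow> real \<Rightarrow> real \<Rightarrow> ennreal \<Rightarrow> ('a \<Rightarrow> real) set" where
  "M_space M s p q =
     {u. u \<in> borel_measurable M \<and>
         (INF g\<in>hajlasz_gradients M s u.
            Lp_norm M p (\<lambda>x. lq_norm q (\<lambda>k. ennreal (g k x)))) < top}"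

end

theory Submission
  imports Defs
begin

text \<open>
  Membership in either space yields a Hajlasz gradient \<open>g\<close> such that the norms of \<open>g k\<close> in \<open>L^p\<close>
  tend to \<open>0\<close> as \<open>k \<rightarrow> \<infinity>\<close>; this is where \<open>q < \<infinity>\<close> enters. Let \<open>P\<close> be the sum of
  \<open>(2^(-j) g j)^p\<close> over \<open>j \<ge> k\<close>. Then \<open>\<bar>u x - u y\<bar> \<le> P(x)^(1/p) + P(y)^(1/p)\<close> whenever
  \<open>d(x, y) < 2^(-k)\<close>, and \<open>\<integral>P = o(2^(-kp))\<close>. Mollify \<open>u\<close> at a scale \<open>r\<close> comparable to \<open>2^(-k)\<close>.
  The mollified function \<open>v\<close> is locally Lipschitz, and a multiple \<open>h\<close> of \<open>A^(1/p) / r\<close>, where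
  \<open>A(x)\<close> is the average of \<open>P\<close> over \<open>B(x, 3r)\<close>, is an upper gradient of it. By Fubini and doubling,
  \<open>\<integral>h^p \<le> const * r^(-p) * \<integral>P \<rightarrow> 0\<close>, so the Poincare inequality forces the mean oscillation of
  \<open>v\<close> on a fixed ball to \<open>0\<close>. Since \<open>v \<rightarrow> u\<close> in \<open>L^1\<close> on balls, \<open>u\<close> is constant on each ball.
\<close>

section \<open>Arc length\<close>

text \<open>The Hajlasz inequality holds only off a null set, and a curve may run inside that set,
  so \<open>u\<close> itself has no evident upper gradient. Mollifying yields a bound at every
  point, valid on every rectifiable curve, so the exceptional family can be empty. Merely bounded
  norms of \<open>g k\<close> would keep the integrals of h^p bounded and no more; their decay is
  what makes the Poincare inequality conclusive. A single \<open>g j\<close> controls only pairs at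
  distance about 2^(-j), while averaging at scale r compares points at all distances below 6r. This
  is why one majorant has to collect all finer scales. The radii fit together as follows. The kernel
  centred at x is supported in radius 2r; if d(z, x) \<le> r, this support lies in B(z, 3r), so a
  single ball serves all x near z. Two points of that ball are less than 6r apart, whence r = 2^(-k)
  / 6. The freedom to evaluate the Lipschitz factor at any nearby z is what allows integration along
  curves.\<close>

definition polygon_length :: "(real \<Rightarrow> 'a::metric_space) \<Rightarrow> nat \<Rightarrow> (nat \<Rightarrow> real) \<Rightarrow> real" where
  "polygon_length \<gamma> n \<tau> = (\<Sum>i<n. dist (\<gamma> (\<tau> i)) (\<gamma> (\<tau> (Suc i))))"

lemma polygon_length_nonneg: "0 \<le> polygon_length \<gamma> n \<tau>"
  by (simp add: polygon_length_def sum_nonneg)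

lemma polygon_length_le_curve_length:
  assumes "mono \<tau>" "range \<tau> \<subseteq> {0..t}"
  shows "ennreal (polygon_length \<gamma> n \<tau>) \<le> curve_length \<gamma> t"
  unfolding curve_length_def polygon_length_def
  by (rule SUP_upper2[of "(n, \<tau>)"]) (use assms in auto)

lemma curve_length_leI:
  assumes "\<And>n \<tau>. mono \<tau> \<Longrightarrow> range \<tau> \<subseteq> {0..t} \<Longrightarrow> ennreal (polygon_length \<gamma> n \<tau>) \<le> c"
  shows "curve_length \<gamma> t \<le> c"
  unfolding curve_length_def using assms by (auto intro!: SUP_least simp: polygon_length_def)

lemma curve_length_mono: "s \<le> t \<Longrightarrow> curve_length \<gamma> s \<le> curve_length \<gamma> t"
  by (rule curve_length_leI, rule polygon_length_le_curve_length) auto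

text \<open>The edge joining the two polygons has nonnegative length, so the joint polygon is at
  least as long as both parts together.\<close>

lemma polygon_length_concat:
  assumes "mono \<tau>" "range \<tau> \<subseteq> {0..a}" "mono \<sigma>" "range \<sigma> \<subseteq> {a..b}"
  shows "ennreal (polygon_length \<gamma> n \<tau> + polygon_length \<gamma> m \<sigma>) \<le> curve_length \<gamma> b"
proof -
  \<comment> \<open>Index \<open>n\<close> is the last vertex of \<open>\<tau>\<close> and
    \<open>Suc n\<close> the first of \<open>\<sigma>\<close>: \<open>n\<close> edges, one joining
    edge, then \<open>m\<close> edges.\<close>
  define \<rho> where "\<rho> i = (if i \<le> n then \<tau> i else \<sigma> (i - Suc n))" for i
  have \<tau>: "0 \<le> \<tau> i" "\<tau> i \<le> a" for i using assms(2) by (auto simp: subset_iff)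
  have \<sigma>: "a \<le> \<sigma> i" "\<sigma> i \<le> b" for i using assms(4) by (auto simp: subset_iff)
  have "mono \<rho>"
  proof (rule monoI)
    fix i j :: nat assume "i \<le> j"
    then show "\<rho> i \<le> \<rho> j"
      using \<tau>(2)[of i] \<sigma>(1)[of "j - Suc n"] monoD[OF assms(1), of i j]
        monoD[OF assms(3), of "i - Suc n" "j - Suc n"]
      by (auto simp: \<rho>_def)
  qed
  moreover have "range \<rho> \<subseteq> {0..b}"
  proof
    fix x assume "x \<in> range \<rho>"
    then obtain i where "x = \<rho> i" by auto
    then show "x \<in> {0..b}"
      using \<tau>[of i] \<sigma>[of i] \<sigma>[of "i - Suc n"] \<tau>[of 0] by (auto simp: \<rho>_def)
  qed
  ultimately have le: "ennreal (polygon_length \<gamma> (Suc n + m) \<rho>) \<le> curve_length \<gamma> b"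
    by (rule polygon_length_le_curve_length)
  have "polygon_length \<gamma> (Suc n + m) \<rho> =
     (\<Sum>i<Suc n. dist (\<gamma> (\<rho> i)) (\<gamma> (\<rho> (Suc i)))) +
     (\<Sum>i<m. dist (\<gamma> (\<rho> (Suc n + i))) (\<gamma> (\<rho> (Suc (Suc n + i)))))"
    unfolding polygon_length_def by (induction m) (simp_all add: add.assoc)
  also have "(\<Sum>i<m. dist (\<gamma> (\<rho> (Suc n + i))) (\<gamma> (\<rho> (Suc (Suc n + i))))) = polygon_length \<gamma> m \<sigma>"
    unfolding polygon_length_def by (rule sum.cong) (auto simp: \<rho>_def Suc_diff_le)
  also have "(\<Sum>i<Suc n. dist (\<gamma> (\<rho> i)) (\<gamma> (\<rho> (Suc i)))) =
      polygon_length \<gamma> n \<tau> + dist (\<gamma> (\<rho> n)) (\<gamma> (\<rho> (Suc n)))"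
    unfolding polygon_length_def by (simp add: \<rho>_def)
  finally have "polygon_length \<gamma> n \<tau> + polygon_length \<gamma> m \<sigma> \<le> polygon_length \<gamma> (Suc n + m) \<rho>"
    by simp
  then show ?thesis using le by (meson ennreal_leI order_trans)
qed

text \<open>Superadditivity of length: by concatenation every polygon on \<open>[0,a]\<close> leaves
  room for \<open>\<sigma>\<close> below the length up to \<open>b\<close>; then pass to the
  supremum.\<close>

lemma curve_length_add_polygon_length:
  assumes "mono \<sigma>" "range \<sigma> \<subseteq> {a..b}" "curve_length \<gamma> b < top" "0 \<le> a"
  shows "enn2real (curve_length \<gamma> a) + polygon_length \<gamma> m \<sigma> \<le> enn2real (curve_length \<gamma> b)"
proof -
  define L where "L = enn2real (curve_length \<gamma> b)"
  have L: "curve_length \<gamma> b = ennreal L" and L0: "0 \<le> L" using assms(3) by (simp_all add: L_def)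
  have "curve_length \<gamma> a \<le> ennreal (L - polygon_length \<gamma> m \<sigma>)"
  proof (rule curve_length_leI)
    fix n and \<tau> :: "nat \<Rightarrow> real" assume "mono \<tau>" "range \<tau> \<subseteq> {0..a}"
    from polygon_length_concat[OF this assms(1,2), of \<gamma> n m]
    have "polygon_length \<gamma> n \<tau> + polygon_length \<gamma> m \<sigma> \<le> L"
      using L0 by (simp add: L ennreal_le_iff)
    then show "ennreal (polygon_length \<gamma> n \<tau>) \<le> ennreal (L - polygon_length \<gamma> m \<sigma>)"
      by (intro ennreal_leI) simp
  qed
  \<comment> \<open>\<open>ennreal\<close> sends negative reals to 0, so the bound just proved
    becomes a real inequality only once the difference is nonnegative. The edgeless polygon at
    \<open>a\<close> shows this.\<close>
  moreover have "polygon_length \<gamma> m \<sigma> \<le> L"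
  proof -
    have "mono (\<lambda>_::nat. a)" "range (\<lambda>_::nat. a) \<subseteq> {0..a}" using assms(4) by (auto simp: mono_def)
    from polygon_length_concat[OF this assms(1,2), of \<gamma> 0 m]
    show ?thesis using L0 by (simp add: L polygon_length_def ennreal_le_iff)
  qed
  ultimately show ?thesis
    unfolding L_def[symmetric] using enn2real_leI[of "L - polygon_length \<gamma> m \<sigma>" "curve_length \<gamma> a"] by simp
qed

text \<open>Each edge is routed through \<open>\<gamma> s\<close> and \<open>\<gamma> t\<close>
  where it crosses these parameters; clamping collapses to a point whatever lies outside the
  respective interval.\<close>

lemma polygon_length_clamp_le:
  assumes "s \<le> t"
  shows "polygon_length \<gamma> n \<tau> \<le> polygon_length \<gamma> n (\<lambda>i. min (\<tau> i) s) +
    polygon_length \<gamma> n (\<lambda>i. max s (min (\<tau> i) t)) + polygon_length \<gamma> n (\<lambda>i. max (\<tau> i) t)"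
proof -
  have *: "dist (\<gamma> a) (\<gamma> b) \<le> dist (\<gamma> (min a s)) (\<gamma> (min b s)) +
      dist (\<gamma> (max s (min a t))) (\<gamma> (max s (min b t))) + dist (\<gamma> (max a t)) (\<gamma> (max b t))" for a b
  proof -
    have tri: "dist x y \<le> dist x z + dist z y" for x y z :: 'a by (rule dist_triangle)
    consider "a \<le> s" | "s < a" "a \<le> t" | "t < a" by linarith
    then show ?thesis
    proof cases
      case 1
      then show ?thesis
        using assms tri[of "\<gamma> a" "\<gamma> b" "\<gamma> s"] tri[of "\<gamma> s" "\<gamma> b" "\<gamma> t"]
        by (cases "b \<le> s"; cases "b \<le> t") (auto simp: min_def max_def)
    next
      case 2
      then show ?thesis
        using assms tri[of "\<gamma> a" "\<gamma> b" "\<gamma> s"] tri[of "\<gamma> a" "\<gamma> b" "\<gamma> t"]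
        by (cases "b \<le> s"; cases "b \<le> t") (auto simp: min_def max_def)
    next
      case 3
      then show ?thesis
        using assms tri[of "\<gamma> a" "\<gamma> b" "\<gamma> t"] tri[of "\<gamma> t" "\<gamma> b" "\<gamma> s"]
        by (cases "b \<le> s"; cases "b \<le> t") (auto simp: min_def max_def)
    qed
  qed
  show ?thesis
    unfolding polygon_length_def sum.distrib[symmetric] by (intro sum_mono) (use * in auto)
qed

text \<open>
  A polygon inscribed in \<open>\<gamma>\<close> with almost full length is split by clamping its parameters to
  \<open>[0,s]\<close>, \<open>[s,t]\<close> and \<open>[t,1]\<close>; its middle part is short by uniform continuity of \<open>\<gamma>\<close>.
\<close>

lemma curve_length_continuous:
  assumes "path \<gamma>" "curve_length \<gamma> 1 < top"
  shows "continuous_on {0..1} (\<lambda>t. enn2real (curve_length \<gamma> t))"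
proof -
  define l where "l t = enn2real (curve_length \<gamma> t)" for t
  have fin: "curve_length \<gamma> t < top" if "t \<le> 1" for t
    using curve_length_mono[OF that, of \<gamma>] assms(2) by (rule order_le_less_trans)
  have lmono: "l s \<le> l t" if "s \<le> t" "t \<le> 1" for s t
    unfolding l_def using curve_length_mono[OF that(1), of \<gamma>] fin[OF that(2)] by (rule enn2real_mono)
  have key: "\<exists>d>0. \<forall>s\<in>{0..1}. \<forall>t\<in>{0..1}. s \<le> t \<and> t - s < d \<longrightarrow> l t < l s + e" if e: "e > 0" for e
  proof -
    have "\<exists>n \<tau>. mono \<tau> \<and> range \<tau> \<subseteq> {0..1} \<and> l 1 - e / 2 < polygon_length \<gamma> n \<tau>"
    proof (rule ccontr)
      assume "\<not> ?thesis"
      then have le: "polygon_length \<gamma> n \<tau> \<le> l 1 - e / 2"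
        if "mono \<tau>" "range \<tau> \<subseteq> {0..1}" for n \<tau>
        using that by (auto simp: not_less)
      then have "curve_length \<gamma> 1 \<le> ennreal (l 1 - e / 2)"
        by (intro curve_length_leI ennreal_leI)
      moreover have "curve_length \<gamma> 1 = ennreal (l 1)" using assms(2) by (simp add: l_def)
      moreover have "0 \<le> l 1 - e / 2"
        using le[of "\<lambda>_. 0" 0] by (simp add: polygon_length_def mono_def)
      ultimately show False using that by (simp add: ennreal_le_iff)
    qed
    then obtain n \<tau> where \<tau>: "mono \<tau>" "range \<tau> \<subseteq> {0..1}" "l 1 - e / 2 < polygon_length \<gamma> n \<tau>" by blast
    have \<tau>01: "0 \<le> \<tau> i" "\<tau> i \<le> 1" for i using \<tau>(2) by (auto simp: subset_iff)
    have "uniformly_continuous_on {0..1} \<gamma>"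
      using assms(1) by (auto simp: path_def intro: compact_uniformly_continuous)
    then obtain d where d: "d > 0" "\<And>x y. x\<in>{0..1} \<Longrightarrow> y\<in>{0..1} \<Longrightarrow> dist x y < d \<Longrightarrow>
        dist (\<gamma> x) (\<gamma> y) < e / (2 * (n + 1))"
      using divide_pos_pos[OF e, of "2 + 2 * real n"] unfolding uniformly_continuous_on_def
      by (elim allE[of _ "e / (2 * (n + 1))"]) (auto simp: add.commute)
    show ?thesis
    proof (intro exI[of _ d] conjI ballI impI)
      show "d > 0" by fact
      fix s t :: real assume st: "s \<in> {0..1}" "t \<in> {0..1}" "s \<le> t \<and> t - s < d"
      \<comment> \<open>Each of the \<open>n\<close> edges is below
        \<open>e / (2 * (n + 1))\<close>; the \<open>n + 1\<close> covers \<open>n = 0\<close> and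
        keeps the sum strictly below \<open>e / 2\<close>.\<close>
      have "polygon_length \<gamma> n (\<lambda>i. max s (min (\<tau> i) t)) \<le> (\<Sum>i<n. e / (2 * (n + 1)))"
        unfolding polygon_length_def
      proof (intro sum_mono less_imp_le d(2))
        fix i
        show "max s (min (\<tau> i) t) \<in> {0..1}" "max s (min (\<tau> (Suc i)) t) \<in> {0..1}" using st by auto
        show "dist (max s (min (\<tau> i) t)) (max s (min (\<tau> (Suc i)) t)) < d"
          using st d(1) by (auto simp: dist_real_def)
      qed
      also have "\<dots> < e / 2" using that by (simp add: field_simps)
      finally have 1: "polygon_length \<gamma> n (\<lambda>i. max s (min (\<tau> i) t)) < e / 2" .
      have m1: "mono (\<lambda>i. min (\<tau> i) s)" "mono (\<lambda>i. max (\<tau> i) t)"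
        using \<tau>(1) by (auto simp: mono_def intro: min.coboundedI1 max.coboundedI1)
      have "ennreal (polygon_length \<gamma> n (\<lambda>i. min (\<tau> i) s)) \<le> curve_length \<gamma> s"
        by (rule polygon_length_le_curve_length) (use m1 \<tau>01 st in auto)
      then have 2: "polygon_length \<gamma> n (\<lambda>i. min (\<tau> i) s) \<le> l s"
        using fin[of s] st enn2real_mono[of "ennreal (polygon_length \<gamma> n (\<lambda>i. min (\<tau> i) s))" "curve_length \<gamma> s"]
          by (simp add: l_def polygon_length_nonneg)
      have 3: "l t + polygon_length \<gamma> n (\<lambda>i. max (\<tau> i) t) \<le> l 1"
        unfolding l_def by (rule curve_length_add_polygon_length) (use m1 \<tau>01 st assms in auto)
      \<comment> \<open>Clamping gives
        \<open>l 1 - e / 2 < l s + e / 2 + (l 1 - l t)\<close>.\<close>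
      show "l t < l s + e"
        using 1 2 3 \<tau>(3) polygon_length_clamp_le[of s t \<gamma> n \<tau>] st by linarith
    qed
  qed
  have "uniformly_continuous_on {0..1} l"
    unfolding uniformly_continuous_on_def
  proof (intro allI impI)
    fix e :: real assume "e > 0"
    from key[OF this] obtain d where d: "d > 0"
      "\<And>s t. s\<in>{0..1} \<Longrightarrow> t\<in>{0..1} \<Longrightarrow> s \<le> t \<Longrightarrow> t - s < d \<Longrightarrow> l t < l s + e" by blast
    show "\<exists>d>0. \<forall>x\<in>{0..1}. \<forall>x'\<in>{0..1}. dist x' x < d \<longrightarrow> dist (l x') (l x) < e"
    proof (intro exI[of _ d] conjI ballI impI)
      fix x x' :: real assume *: "x \<in> {0..1}" "x' \<in> {0..1}" "dist x' x < d"
      show "dist (l x') (l x) < e"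
      proof (cases "x \<le> x'")
        case True
        then show ?thesis using d(2)[of x x'] lmono[of x x'] * by (auto simp: dist_real_def)
      next
        case False
        then show ?thesis using d(2)[of x' x] lmono[of x' x] * by (auto simp: dist_real_def)
      qed
    qed (fact d(1))
  qed
  then show ?thesis
    unfolding l_def by (rule uniformly_continuous_imp_continuous)
qed

section \<open>The arc length parametrisation as a 1-Lipschitz map\<close>

lemma dist_le_curve_length_diff:
  assumes "curve_length \<gamma> 1 < top" "0 \<le> s" "s \<le> t" "t \<le> 1"
  shows "dist (\<gamma> s) (\<gamma> t) \<le> enn2real (curve_length \<gamma> t) - enn2real (curve_length \<gamma> s)"
proof -
  define \<sigma> where "\<sigma> i = (if i = 0 then s else t)" for i :: nat
  have "curve_length \<gamma> t < top" using curve_length_mono[OF assms(4), of \<gamma>] assms(1) by (rule order_le_less_trans)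
  then have "enn2real (curve_length \<gamma> s) + polygon_length \<gamma> 1 \<sigma> \<le> enn2real (curve_length \<gamma> t)"
    by (intro curve_length_add_polygon_length) (use assms in \<open>auto simp: \<sigma>_def mono_def\<close>)
  then show ?thesis by (simp add: polygon_length_def \<sigma>_def)
qed

text \<open>The length function is continuous, so by the intermediate value theorem it attains every
  value in the interval; this makes \<open>inv_into\<close> return a genuine preimage instead of an
  arbitrary point.\<close>

lemma arclength_param_eq:
  assumes "\<gamma> \<in> rect_curves" "s \<in> {0..enn2real (curve_length \<gamma> 1)}"
  obtains t where "t \<in> {0..1}" "enn2real (curve_length \<gamma> t) = s" "arclength_param \<gamma> s = \<gamma> t"
proof -
  define l where "l = (\<lambda>t. enn2real (curve_length \<gamma> t))"
  have \<gamma>: "path \<gamma>" "curve_length \<gamma> 1 < top" using assms(1) by (auto simp: rect_curves_def)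
  have "curve_length \<gamma> 0 \<le> 0"
  proof (rule curve_length_leI)
    fix n and \<tau> :: "nat \<Rightarrow> real" assume "range \<tau> \<subseteq> {0..0}"
    then have "\<tau> i = 0" for i by auto
    then show "ennreal (polygon_length \<gamma> n \<tau>) \<le> 0" by (simp add: polygon_length_def)
  qed
  then have "l 0 = 0" by (simp add: l_def)
  then have "\<exists>t\<ge>0. t \<le> 1 \<and> l t = s"
    by (intro IVT') (use assms(2) curve_length_continuous[OF \<gamma>] in \<open>auto simp: l_def\<close>)
  then have "s \<in> l ` {0..1}" by force
  then have "inv_into {0..1} l s \<in> {0..1}" "l (inv_into {0..1} l s) = s"
    by (rule inv_into_into, rule f_inv_into_f)
  then show ?thesis
    by (intro that[of "inv_into {0..1} l s"]) (auto simp: l_def arclength_param_def)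
qed

lemma dist_arclength_param_le:
  assumes "\<gamma> \<in> rect_curves"
    and "s \<in> {0..enn2real (curve_length \<gamma> 1)}" "s' \<in> {0..enn2real (curve_length \<gamma> 1)}"
  shows "dist (arclength_param \<gamma> s) (arclength_param \<gamma> s') \<le> \<bar>s - s'\<bar>"
proof -
  obtain t where t: "t \<in> {0..1}" "enn2real (curve_length \<gamma> t) = s" "arclength_param \<gamma> s = \<gamma> t"
    using arclength_param_eq[OF assms(1,2)] .
  obtain t' where t': "t' \<in> {0..1}" "enn2real (curve_length \<gamma> t') = s'" "arclength_param \<gamma> s' = \<gamma> t'"
    using arclength_param_eq[OF assms(1,3)] .
  have fin: "curve_length \<gamma> 1 < top" using assms(1) by (auto simp: rect_curves_def)
  show ?thesis
    using dist_le_curve_length_diff[OF fin, of t t'] dist_le_curve_length_diff[OF fin, of t' t] t t'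
    by (cases "t \<le> t'") (auto simp: dist_commute)
qed

text \<open>If the curve rests at an end, the chosen preimage need not be 0 or 1, but the arc
  between them has length zero and so stays at one point.\<close>

lemma arclength_param_endpoints:
  assumes "\<gamma> \<in> rect_curves"
  shows "arclength_param \<gamma> 0 = pathstart \<gamma>"
    and "arclength_param \<gamma> (enn2real (curve_length \<gamma> 1)) = pathfinish \<gamma>"
proof -
  have fin: "curve_length \<gamma> 1 < top" using assms(1) by (auto simp: rect_curves_def)
  obtain t where t: "t \<in> {0..1}" "enn2real (curve_length \<gamma> t) = 0" "arclength_param \<gamma> 0 = \<gamma> t"
    using arclength_param_eq[OF assms, of 0] by auto
  show "arclength_param \<gamma> 0 = pathstart \<gamma>"
    using dist_le_curve_length_diff[OF fin, of 0 t] t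
    by (auto simp: pathstart_def) (smt (verit) dist_le_zero_iff enn2real_nonneg)
  obtain t where t: "t \<in> {0..1}" "enn2real (curve_length \<gamma> t) = enn2real (curve_length \<gamma> 1)"
      "arclength_param \<gamma> (enn2real (curve_length \<gamma> 1)) = \<gamma> t"
    using arclength_param_eq[OF assms, of "enn2real (curve_length \<gamma> 1)"] by auto
  show "arclength_param \<gamma> (enn2real (curve_length \<gamma> 1)) = pathfinish \<gamma>"
    using dist_le_curve_length_diff[OF fin, of t 1] t by (auto simp: pathfinish_def)
qed

text \<open>
  The factor \<open>f\<close> may be evaluated at any nearby point, so averaging over short intervals replaces
  the a.e. differentiability of Lipschitz functions.
\<close>

lemma abs_diff_le_nn_integral_of_local_bound:
  fixes v :: "real \<Rightarrow> real" and f :: "real \<Rightarrow> ennreal"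
  assumes "0 \<le> L" "0 < d"
    and bound: "\<And>s s' z. s \<in> {0..L} \<Longrightarrow> s' \<in> {0..L} \<Longrightarrow> z \<in> {0..L} \<Longrightarrow> \<bar>s - z\<bar> < d \<Longrightarrow> \<bar>s' - z\<bar> < d \<Longrightarrow>
        ennreal \<bar>v s - v s'\<bar> \<le> ennreal \<bar>s - s'\<bar> * f z"
  shows "ennreal \<bar>v 0 - v L\<bar> \<le> (\<integral>\<^sup>+s\<in>{0..L}. f s \<partial>lborel)"
proof (cases "L = 0")
  case True
  then show ?thesis by simp
next
  case False
  with assms(1) have "L > 0" by simp
  \<comment> \<open>Enough cells to make each shorter than \<open>d\<close>: every \<open>z\<close>
    in a cell is then within \<open>d\<close> of both its ends, and \<open>bound\<close> applies
    with the factor \<open>f z\<close>.\<close>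
  obtain N :: nat where N: "L / d < real N" using reals_Archimedean2 by blast
  with \<open>L > 0\<close> \<open>d > 0\<close> have N0: "N > 0" by (metis divide_pos_pos less_trans of_nat_0_less_iff)
  define \<delta> where "\<delta> = L / N"
  have \<delta>: "0 < \<delta>" "\<delta> < d" "N * \<delta> = L"
    using N N0 \<open>L > 0\<close> \<open>d > 0\<close> by (auto simp: \<delta>_def field_simps)
  \<comment> \<open>Half-open cells are disjoint, so at most one term of the step function below is
    nonzero at any point.\<close>
  define I where "I i = {real i * \<delta> ..< real (Suc i) * \<delta>}" for i
  define c where "c i = \<bar>v (real i * \<delta>) - v (real (Suc i) * \<delta>)\<bar>" for i
  have le: "real (Suc i) * \<delta> \<le> L" if "i < N" for i
  proof -
    have "real (Suc i) * \<delta> \<le> N * \<delta>" by (intro mult_right_mono) (use that \<delta> in auto)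
    then show ?thesis using \<delta> by simp
  qed
  have I0L: "I i \<subseteq> {0..L}" if "i < N" for i
    using le[OF that] \<delta>(1) by (auto simp: I_def) (smt (verit) mult_nonneg_nonneg of_nat_0_le_iff)
  \<comment> \<open>On a whole cell \<open>f\<close> is at least the difference quotient of
    \<open>v\<close> across it, so these quotients form a step function below
    \<open>f\<close>.\<close>
  have step: "ennreal (c i / \<delta>) \<le> f z" if "i < N" "z \<in> I i" for i z
  proof -
    have z: "real i * \<delta> \<le> z" "z < real i * \<delta> + \<delta>" using that by (auto simp: I_def algebra_simps)
    have "ennreal (c i) \<le> ennreal \<bar>real i * \<delta> - real (Suc i) * \<delta>\<bar> * f z"
      unfolding c_def
    proof (rule bound)
      show "z \<in> {0..L}" using I0L[OF that(1)] that(2) by blast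
      show "real i * \<delta> \<in> {0..L}" "real (Suc i) * \<delta> \<in> {0..L}" using le[OF that(1)] \<delta> by (auto simp: algebra_simps)
      show "\<bar>real i * \<delta> - z\<bar> < d" "\<bar>real (Suc i) * \<delta> - z\<bar> < d" using z \<delta> by (auto simp: algebra_simps)
    qed
    also have "\<bar>real i * \<delta> - real (Suc i) * \<delta>\<bar> = \<delta>" using \<delta> by (simp add: algebra_simps)
    finally have "ennreal (c i) / ennreal \<delta> \<le> f z"
      using \<delta>(1) by (intro divide_le_posI_ennreal) auto
    then show ?thesis using \<delta>(1) by (simp add: divide_ennreal c_def)
  qed
  have disj: "i = j" if "s \<in> I i" "s \<in> I j" for i j s
  proof -
    have *: "a \<le> b" if "s \<in> I a" "s \<in> I b" for a b
    proof -
      have "real a * \<delta> < real (Suc b) * \<delta>" using that by (auto simp: I_def)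
      then show ?thesis using \<delta>(1) by (simp add: mult_less_cancel_right)
    qed
    show ?thesis using *[of i j] *[of j i] that by auto
  qed
  have "\<bar>v 0 - v (real n * \<delta>)\<bar> \<le> (\<Sum>i<n. c i)" for n
  proof (induction n)
    case (Suc n)
    then show ?case unfolding c_def by simp
  qed simp
  from this[of N] have "ennreal \<bar>v 0 - v L\<bar> \<le> (\<Sum>i<N. ennreal (c i))"
    using \<delta>(3) by (subst sum_ennreal) (auto simp: c_def intro: ennreal_leI)
  also have "\<dots> = (\<Sum>i<N. \<integral>\<^sup>+s. ennreal (c i / \<delta>) * indicator (I i) s \<partial>lborel)"
  proof (rule sum.cong[OF refl])
    fix i
    have "emeasure lborel (I i) = ennreal \<delta>"
      unfolding I_def using \<delta>(1) by (subst emeasure_lborel_Ico) (auto simp: algebra_simps)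
    then show "ennreal (c i) = (\<integral>\<^sup>+s. ennreal (c i / \<delta>) * indicator (I i) s \<partial>lborel)"
      using \<delta>(1) by (simp add: nn_integral_cmult_indicator I_def ennreal_mult[symmetric] c_def)
  qed
  also have "\<dots> = (\<integral>\<^sup>+s. (\<Sum>i<N. ennreal (c i / \<delta>) * indicator (I i) s) \<partial>lborel)"
    by (rule nn_integral_sum[symmetric]) (auto simp: I_def)
  also have "\<dots> \<le> (\<integral>\<^sup>+s\<in>{0..L}. f s \<partial>lborel)"
  proof (rule nn_integral_mono)
    fix s
    show "(\<Sum>i<N. ennreal (c i / \<delta>) * indicator (I i) s) \<le> f s * indicator {0..L} s"
    proof (cases "\<exists>i<N. s \<in> I i")
      case True
      then obtain i where i: "i < N" "s \<in> I i" by blast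
      have "(\<Sum>j<N. ennreal (c j / \<delta>) * indicator (I j) s) = (\<Sum>j<N. if j = i then ennreal (c i / \<delta>) else 0)"
        by (rule sum.cong) (use disj i in \<open>auto simp: indicator_def\<close>)
      then show ?thesis using i step[OF i] I0L[of i] by (auto simp: indicator_def)
    next
      case False
      then show ?thesis by (simp add: indicator_def)
    qed
  qed
  finally show ?thesis .
qed

text \<open>Since the arc length parametrisation does not increase distances, the local bound passes
  to \<open>v\<close> along the curve. No curve is exceptional: the zero density is admissible for
  the empty family, whose modulus therefore vanishes.\<close>

lemma weak_upper_gradient_of_local_bound:
  fixes v h :: "'a::metric_space \<Rightarrow> real"
  assumes "r > 0" and h: "h \<in> borel_measurable borel" "\<And>x. 0 \<le> h x"
    and bound: "\<And>x x' z. dist z x < r \<Longrightarrow> dist z x' < r \<Longrightarrow> \<bar>v x - v x'\<bar> \<le> dist x x' * h z"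
  shows "weak_upper_gradient M p v h"
  unfolding weak_upper_gradient_def
proof (intro conjI allI h exI[of _ "{}"] ballI)
  have "modulus M p ({} :: (real \<Rightarrow> 'a) set) \<le> (\<integral>\<^sup>+x. ennpowr 0 p \<partial>M)"
    unfolding modulus_def by (rule INF_lower2[of "\<lambda>_. 0"]) auto
  then show "modulus M p ({} :: (real \<Rightarrow> 'a) set) = 0" by (simp add: ennpowr_def)
  fix \<gamma> :: "real \<Rightarrow> 'a" assume "\<gamma> \<in> rect_curves - {}"
  then have \<gamma>: "\<gamma> \<in> rect_curves" by simp
  define L where "L = enn2real (curve_length \<gamma> 1)"
  define \<eta> where "\<eta> = arclength_param \<gamma>"
  have lip: "dist (\<eta> s) (\<eta> s') \<le> \<bar>s - s'\<bar>" if "s \<in> {0..L}" "s' \<in> {0..L}" for s s'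
    using dist_arclength_param_le[OF \<gamma>] that unfolding L_def \<eta>_def .
  have "ennreal \<bar>v (\<eta> 0) - v (\<eta> L)\<bar> \<le> (\<integral>\<^sup>+s\<in>{0..L}. ennreal (h (\<eta> s)) \<partial>lborel)"
  proof (rule abs_diff_le_nn_integral_of_local_bound[where d = r])
    fix s s' z assume *: "s \<in> {0..L}" "s' \<in> {0..L}" "z \<in> {0..L}" "\<bar>s - z\<bar> < r" "\<bar>s' - z\<bar> < r"
    have "\<bar>v (\<eta> s) - v (\<eta> s')\<bar> \<le> dist (\<eta> s) (\<eta> s') * h (\<eta> z)"
      by (rule bound) (use * lip[of z s] lip[of z s'] in auto)
    also have "\<dots> \<le> \<bar>s - s'\<bar> * h (\<eta> z)" by (intro mult_right_mono lip h * )
    finally show "ennreal \<bar>v (\<eta> s) - v (\<eta> s')\<bar> \<le> ennreal \<bar>s - s'\<bar> * ennreal (h (\<eta> z))"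
      by (subst ennreal_mult[symmetric]) (auto simp: h intro: ennreal_leI)
  qed (auto simp: L_def assms(1))
  then show "ennreal \<bar>v (pathstart \<gamma>) - v (pathfinish \<gamma>)\<bar> \<le> line_integral (\<lambda>x. ennreal (h x)) \<gamma>"
    using arclength_param_endpoints[OF \<gamma>] by (simp add: line_integral_def L_def \<eta>_def)
qed simp

section \<open>Averages over balls in doubling spaces\<close>

locale doubling_mms =
  fixes M :: "'a::metric_space measure" and C \<nu> :: real
  assumes space_M: "space M = UNIV" and borel_subset: "sets borel \<subseteq> sets M"
    and C_gt_1: "C > 1" and \<nu>_pos: "\<nu> > 0"
    and emeasure_ball_pos: "r > 0 \<Longrightarrow> 0 < emeasure M (ball x r)"
    and emeasure_ball_finite: "r > 0 \<Longrightarrow> emeasure M (ball x r) < top"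
    and emeasure_ball_scale: "r > 0 \<Longrightarrow> l > 1 \<Longrightarrow>
      emeasure M (ball x (l * r)) \<le> ennreal (C * l powr \<nu>) * emeasure M (ball x r)"
begin

text \<open>The doubling constant for dilation by 4. This factor covers every comparison made below,
  in particular that of B(z, 3r) with B(x, r) when d(z, x) \<le> r.\<close>

definition K :: real where "K = C * 4 powr \<nu>"

lemma K_ge_1: "1 \<le> K"
proof -
  have "1 * 1 \<le> C * 4 powr \<nu>"
    by (intro mult_mono) (use C_gt_1 \<nu>_pos in \<open>auto simp: ge_one_powr_ge_zero\<close>)
  then show ?thesis by (simp add: K_def)
qed

lemma borel_measurable_M: "f \<in> borel_measurable borel \<Longrightarrow> f \<in> borel_measurable M"
  using borel_subset by (auto simp: measurable_def space_M)

lemma open_sets_M [measurable]: "open S \<Longrightarrow> S \<in> sets M"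
  using borel_subset by auto

lemma ball_sets_M [measurable]: "ball x r \<in> sets M"
  by simp

lemma emeasure_ball: "r > 0 \<Longrightarrow> emeasure M (ball x r) = ennreal (measure M (ball x r))"
  using emeasure_ball_finite[of r x] by (simp add: emeasure_eq_ennreal_measure)

lemma measure_ball_pos: "r > 0 \<Longrightarrow> 0 < measure M (ball x r)"
  using emeasure_ball_pos[of r x] emeasure_ball[of r x] by simp

lemma fmeasurable_ball: "ball x r \<in> fmeasurable M"
  using emeasure_ball_finite[of r x] by (cases "r > 0") (auto simp: fmeasurable_def ball_empty)

lemma measure_ball_mono: "dist x y + r \<le> s \<Longrightarrow> measure M (ball y r) \<le> measure M (ball x s)"
  by (intro measure_mono_fmeasurable fmeasurable_ball)
    (auto simp: subset_iff, smt (verit) dist_triangle)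

lemma measure_ball_scale:
  assumes "r > 0" "l > 1"
  shows "measure M (ball x (l * r)) \<le> C * l powr \<nu> * measure M (ball x r)"
  using emeasure_ball_scale[OF assms, of x] assms C_gt_1
  by (simp add: emeasure_ball ennreal_mult[symmetric] ennreal_le_iff)

lemma measure_ball_le_K:
  assumes "r > 0" "dist x y + s \<le> 4 * r"
  shows "measure M (ball y s) \<le> K * measure M (ball x r)"
  using measure_ball_mono[OF assms(2)] measure_ball_scale[of r 4 x] assms(1) by (simp add: K_def)

lemma UN_balls: "(\<Union>i::nat. ball x (real i + 1)) = UNIV"
proof -
  have "\<exists>i::nat. dist x y < real i + 1" for y
    using real_arch_simple[of "dist x y"] by (meson add_strict_increasing2 le_less_trans less_add_one)
  then show ?thesis by auto
qed

text \<open>Needed for Fubini in \<open>nn_integral_ball_avg_le\<close>.\<close>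

sublocale sigma_finite_measure M
proof
  let ?A = "range (\<lambda>i::nat. ball (undefined :: 'a) (real i + 1))"
  show "\<exists>A. countable A \<and> A \<subseteq> sets M \<and> \<Union>A = space M \<and> (\<forall>a\<in>A. emeasure M a \<noteq> \<infinity>)"
    by (rule exI[of _ ?A]) (use emeasure_ball_finite UN_balls[of undefined] in \<open>auto simp: space_M less_top\<close>)
qed

section \<open>Separability and measurability of the distance\<close>

text \<open>Packing: the balls of radius \<open>\<delta> / 2\<close> around a
  \<open>\<delta>\<close>-separated set are disjoint, have measure at least \<open>c\<close> by
  doubling, and lie in one ball of finite measure. This bounds the cardinality, and a separated set
  of maximal cardinality is a net.\<close>

lemma finite_net:
  fixes x0 :: 'a
  assumes "0 < N" "0 < \<delta>"
  shows "\<exists>F. finite F \<and> (\<forall>x\<in>ball x0 N. \<exists>z\<in>F. dist x z < \<delta>)"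
proof -
  define S where "S F \<longleftrightarrow> finite F \<and> F \<subseteq> ball x0 N \<and> (\<forall>x\<in>F. \<forall>y\<in>F. x \<noteq> y \<longrightarrow> \<delta> \<le> dist x y)" for F
  \<comment> \<open>Chosen so that \<open>l * (\<delta> / 2)\<close> exceeds \<open>2 * N\<close>:
    the enlarged ball around any \<open>z\<close> in \<open>ball x0 N\<close> contains
    \<open>ball x0 N\<close>.\<close>
  define l where "l = 2 * N / (\<delta> / 2) + 1"
  define c where "c = measure M (ball x0 N) / (C * l powr \<nu>)"
  have l: "l > 1" using assms by (simp add: l_def)
  have Cl: "0 < C * l powr \<nu>" using C_gt_1 l by simp
  have c: "c > 0" unfolding c_def using measure_ball_pos[OF assms(1)] Cl by simp
  have low: "c \<le> measure M (ball z (\<delta> / 2))" if "z \<in> ball x0 N" for z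
  proof -
    have "l * (\<delta> / 2) = 2 * N + \<delta> / 2" using assms by (simp add: l_def field_simps)
    then have "measure M (ball x0 N) \<le> measure M (ball z (l * (\<delta> / 2)))"
      by (intro measure_ball_mono) (use that assms in \<open>auto simp: dist_commute\<close>)
    also have "\<dots> \<le> C * l powr \<nu> * measure M (ball z (\<delta> / 2))"
      by (rule measure_ball_scale) (use assms l in auto)
    finally show ?thesis using Cl by (simp add: c_def field_simps)
  qed
  have card: "real (card F) * c \<le> measure M (ball x0 (N + \<delta>))" if "S F" for F
  proof -
    have F: "finite F" "F \<subseteq> ball x0 N" "\<And>x y. x \<in> F \<Longrightarrow> y \<in> F \<Longrightarrow> x \<noteq> y \<Longrightarrow> \<delta> \<le> dist x y"
      using that by (auto simp: S_def)
    have "real (card F) * c = (\<Sum>z\<in>F. c)" by simp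
    also have "\<dots> \<le> (\<Sum>z\<in>F. measure M (ball z (\<delta> / 2)))" by (intro sum_mono low) (use F in auto)
    also have "\<dots> = measure M (\<Union>z\<in>F. ball z (\<delta> / 2))"
    proof (rule measure_UNION'[symmetric])
      show "pairwise (\<lambda>x y. disjnt (ball x (\<delta> / 2)) (ball y (\<delta> / 2))) F"
      proof (rule pairwiseI)
        fix x y assume "x \<in> F" "y \<in> F" "x \<noteq> y"
        from F(3)[OF this] show "disjnt (ball x (\<delta> / 2)) (ball y (\<delta> / 2))"
          by (auto simp: disjnt_iff) (smt (verit) dist_triangle dist_commute field_sum_of_halves)
      qed
    qed (use F(1) fmeasurable_ball in auto)
    also have "\<dots> \<le> measure M (ball x0 (N + \<delta>))"
    proof (intro measure_mono_fmeasurable fmeasurable_ball)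
      show "(\<Union>z\<in>F. ball z (\<delta> / 2)) \<subseteq> ball x0 (N + \<delta>)"
        using F(2) assms by (auto simp: subset_iff) (smt (verit) dist_triangle field_sum_of_halves)
    qed (auto intro!: open_sets_M)
    finally show ?thesis .
  qed
  have bd: "card F < nat \<lceil>measure M (ball x0 (N + \<delta>)) / c\<rceil> + 1" if "S F" for F
  proof -
    have "real (card F) \<le> measure M (ball x0 (N + \<delta>)) / c" using card[OF that] c by (simp add: field_simps)
    also have "\<dots> \<le> real (nat \<lceil>measure M (ball x0 (N + \<delta>)) / c\<rceil>)" by (rule real_nat_ceiling_ge)
    finally show ?thesis by simp
  qed
  have "S {}" by (simp add: S_def)
  then obtain F where F: "S F" "\<And>G. S G \<Longrightarrow> card G \<le> card F"
    using ex_has_greatest_nat[of S "{}" card] bd by blast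
  have "\<exists>z\<in>F. dist x z < \<delta>" if x: "x \<in> ball x0 N" for x
  proof (rule ccontr)
    assume *: "\<not> ?thesis"
    then have "S (insert x F)" using F(1) x unfolding S_def by (auto simp: dist_commute not_less)
    moreover have "x \<notin> F" using * assms by auto
    ultimately show False using F(2)[of "insert x F"] F(1) by (auto simp: S_def)
  qed
  then show ?thesis using F(1) by (auto simp: S_def)
qed

lemma countable_dense:
  obtains Q :: "'a set" where "countable Q" "\<And>x e. 0 < e \<Longrightarrow> \<exists>z\<in>Q. dist x z < e"
proof -
  have "\<forall>i j :: nat. \<exists>F. finite F \<and> (\<forall>x\<in>ball (undefined :: 'a) (real i + 1). \<exists>z\<in>F. dist x z < inverse (real (Suc j)))"
    by (intro allI finite_net) auto
  then obtain F where F: "\<And>i j :: nat. finite (F i j)"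
    "\<And>i j x. x \<in> ball (undefined :: 'a) (real i + 1) \<Longrightarrow> \<exists>z\<in>F i j. dist x z < inverse (real (Suc j))"
    by metis
  show thesis
  proof (rule that[of "\<Union>i j. F i j"])
    show "countable (\<Union>i j. F i j)" using F(1) by (intro countable_UN) (auto intro: countable_finite)
    fix x :: 'a and e :: real assume "0 < e"
    then obtain j where j: "inverse (real (Suc j)) < e" using reals_Archimedean by blast
    obtain i :: nat where "x \<in> ball undefined (real i + 1)" using UN_balls by blast
    from F(2)[OF this, of j] obtain z where "z \<in> F i j" "dist x z < inverse (real (Suc j))" ..
    with j show "\<exists>z\<in>\<Union>i j. F i j. dist x z < e" by (intro bexI[of _ z]) auto
  qed
qed

text \<open>
  The type \<^typ>\<open>'a\<close> is not assumed second countable, so product measurability of the distance needs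
  the separability that doubling provides.
\<close>

lemma sets_pair_dist_less [measurable]: "{z \<in> space (M \<Otimes>\<^sub>M M). dist (fst z) (snd z) < R} \<in> sets (M \<Otimes>\<^sub>M M)"
proof -
  obtain Q :: "'a set" where Q: "countable Q" "\<And>x e. 0 < e \<Longrightarrow> \<exists>z\<in>Q. dist x z < e"
    using countable_dense by blast
  have "{z \<in> space (M \<Otimes>\<^sub>M M). dist (fst z) (snd z) < R} =
      (\<Union>z\<in>Q. \<Union>q\<in>\<rat>. ball z q \<times> ball z (R - q))"
  proof (intro subset_antisym subsetI)
    fix w :: "'a \<times> 'a" assume "w \<in> {z \<in> space (M \<Otimes>\<^sub>M M). dist (fst z) (snd z) < R}"
    then obtain x y where w: "w = (x, y)" "dist x y < R" by (cases w) auto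
    \<comment> \<open>Half the slack: \<open>z\<close> within \<open>e\<close> of \<open>x\<close>
      and \<open>q\<close> below \<open>e\<close> leave
      \<open>dist z y < dist x y + e = R - e < R - q\<close>.\<close>
    define e where "e = (R - dist x y) / 2"
    have "e > 0" using w by (simp add: e_def)
    then obtain z where z: "z \<in> Q" "dist x z < e" using Q(2) by blast
    obtain q where q: "q \<in> \<rat>" "dist x z < q" "q < e" using Rats_dense_in_real[OF z(2)] by blast
    have "dist z y \<le> dist x z + dist x y" using dist_triangle[of z y x] by (simp add: dist_commute)
    then have "dist z y < R - q" using z q by (simp add: e_def field_simps)
    then show "w \<in> (\<Union>z\<in>Q. \<Union>q\<in>\<rat>. ball z q \<times> ball z (R - q))"
      using z q w by (auto simp: dist_commute intro!: bexI[of _ z] bexI[of _ q])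
  next
    fix w :: "'a \<times> 'a" assume "w \<in> (\<Union>z\<in>Q. \<Union>q\<in>\<rat>. ball z q \<times> ball z (R - q))"
    then obtain z q where "dist z (fst w) < q" "dist z (snd w) < R - q" by (auto simp: mem_Times_iff)
    then show "w \<in> {z \<in> space (M \<Otimes>\<^sub>M M). dist (fst z) (snd z) < R}"
      using dist_triangle[of "fst w" "snd w" z] by (auto simp: space_pair_measure space_M dist_commute)
  qed
  also have "\<dots> \<in> sets (M \<Otimes>\<^sub>M M)"
    using Q(1) countable_rat by (intro sets.countable_UN'' pair_measureI ball_sets_M)
  finally show ?thesis .
qed

section \<open>Averaging over balls of fixed radius\<close>

definition ball_avg :: "real \<Rightarrow> ('a \<Rightarrow> ennreal) \<Rightarrow> 'a \<Rightarrow> ennreal" where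
  "ball_avg r f x = (\<integral>\<^sup>+y\<in>ball x r. f y \<partial>M) / emeasure M (ball x r)"

text \<open>The function is lower semicontinuous, because balls are open.\<close>

lemma borel_measurable_nn_integral_ball:
  assumes [measurable]: "f \<in> borel_measurable M"
  shows "(\<lambda>x. \<integral>\<^sup>+y\<in>ball x r. f y \<partial>M) \<in> borel_measurable borel"
proof (rule borel_measurableI_greater)
  fix a :: ennreal
  define F where "F s x = (\<integral>\<^sup>+y\<in>ball x s. f y \<partial>M)" for s x
  have "open {x. a < F r x}"
    unfolding open_dist
  proof (intro ballI)
    fix x assume "x \<in> {x. a < F r x}"
    then have ax: "a < F r x" by simp
    \<comment> \<open>Monotone convergence along an exhaustion of the open ball by smaller
      concentric ones; one of these already has integral above \<open>a\<close>.\<close>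
    have "(SUP i. F (r - inverse (real (Suc i))) x) = F r x"
    proof -
      have "(SUP i. F (r - inverse (real (Suc i))) x) =
         (\<integral>\<^sup>+y. (SUP i. f y * indicator (ball x (r - inverse (real (Suc i)))) y) \<partial>M)"
        unfolding F_def
      proof (rule nn_integral_monotone_convergence_SUP[symmetric])
        show "incseq (\<lambda>i y. f y * indicator (ball x (r - inverse (real (Suc i)))) y)"
        proof (intro monoI le_funI mult_left_mono)
          fix i j :: nat and y assume "i \<le> j"
          then have "inverse (real (Suc j)) \<le> inverse (real (Suc i))" by (intro le_imp_inverse_le) auto
          then have "ball x (r - inverse (real (Suc i))) \<subseteq> ball x (r - inverse (real (Suc j)))"
            by (intro subset_ball diff_left_mono)
          then show "indicator (ball x (r - inverse (real (Suc i)))) y \<le>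
              (indicator (ball x (r - inverse (real (Suc j)))) y :: ennreal)"
            by (auto split: split_indicator)
        qed simp
      qed measurable
      also have "(\<lambda>y. SUP i. f y * indicator (ball x (r - inverse (real (Suc i)))) y) =
          (\<lambda>y. f y * indicator (ball x r) y)"
      proof
        fix y
        show "(SUP i. f y * indicator (ball x (r - inverse (real (Suc i)))) y) = f y * indicator (ball x r) y"
        proof (rule antisym)
          show "(SUP i. f y * indicator (ball x (r - inverse (real (Suc i)))) y) \<le> f y * indicator (ball x r) y"
          proof (rule SUP_least)
            fix i
            have "ball x (r - inverse (real (Suc i))) \<subseteq> ball x r" by (intro subset_ball) simp
            then show "f y * indicator (ball x (r - inverse (real (Suc i)))) y \<le> f y * indicator (ball x r) y"
              by (auto split: split_indicator)
          qed
          show "f y * indicator (ball x r) y \<le> (SUP i. f y * indicator (ball x (r - inverse (real (Suc i)))) y)"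
          proof (cases "dist x y < r")
            case True
            then obtain i where "inverse (real (Suc i)) < r - dist x y"
              using reals_Archimedean[of "r - dist x y"] by auto
            then show ?thesis using True by (intro SUP_upper2[of i]) (auto simp: indicator_def)
          qed simp
        qed
      qed
      finally show ?thesis by (simp add: F_def)
    qed
    with ax have "a < (SUP i. F (r - inverse (real (Suc i))) x)" by simp
    then obtain i where i: "a < F (r - inverse (real (Suc i))) x" by (auto simp: less_SUP_iff)
    show "\<exists>e>0. \<forall>y. dist y x < e \<longrightarrow> y \<in> {x. a < F r x}"
    proof (intro exI[of _ "inverse (real (Suc i))"] conjI allI impI)
      fix y assume y: "dist y x < inverse (real (Suc i))"
      \<comment> \<open>A shift of the centre by less than the gap between the radii keeps the
        smaller ball inside, so the strict inequality persists near \<open>x\<close>.\<close>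
      have "ball x (r - inverse (real (Suc i))) \<subseteq> ball y r"
        using y dist_triangle[of y _ x] by (auto simp: subset_iff) (smt (verit) dist_triangle)
      then have "F (r - inverse (real (Suc i))) x \<le> F r y"
        unfolding F_def by (intro nn_integral_mono) (auto simp: indicator_def)
      with i show "y \<in> {x. a < F r x}" by auto
    qed simp
  qed
  then show "{x \<in> space borel. a < (\<integral>\<^sup>+y\<in>ball x r. f y \<partial>M)} \<in> sets borel"
    by (simp add: F_def)
qed

lemma borel_measurable_ball_avg:
  assumes "f \<in> borel_measurable M"
  shows "ball_avg r f \<in> borel_measurable borel"
proof -
  have "(\<lambda>x. \<integral>\<^sup>+y\<in>ball x r. 1 \<partial>M) \<in> borel_measurable borel"
    by (rule borel_measurable_nn_integral_ball) simp
  then have "(\<lambda>x. emeasure M (ball x r)) \<in> borel_measurable borel" by simp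
  with borel_measurable_nn_integral_ball[OF assms, of r] show ?thesis
    unfolding ball_avg_def[abs_def] by measurable
qed

text \<open>After Fubini the value \<open>f y\<close> carries as weight the integral of
  \<open>1 / emeasure M (ball x r)\<close> over all \<open>x\<close> in \<open>ball y r\<close>.
  Doubling exchanges the centre \<open>x\<close> for \<open>y\<close> at the price of
  \<open>K\<close>, so the weight is at most \<open>K\<close>.\<close>

lemma nn_integral_ball_avg_le:
  assumes [measurable]: "f \<in> borel_measurable M" and "r > 0"
  shows "(\<integral>\<^sup>+x. ball_avg r f x \<partial>M) \<le> ennreal K * (\<integral>\<^sup>+x. f x \<partial>M)"
proof -
  interpret pair_sigma_finite M M ..
  have [measurable]: "(\<lambda>x. emeasure M (ball x r)) \<in> borel_measurable M"
    using borel_measurable_nn_integral_ball[of "\<lambda>_. 1" r] by (intro borel_measurable_M) simp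
  define \<kappa> where "\<kappa> x y = (indicator (ball x r) y :: ennreal)" for x y :: 'a
  have [measurable]: "(\<lambda>(x, y). \<kappa> x y) \<in> borel_measurable (M \<Otimes>\<^sub>M M)"
    unfolding \<kappa>_def case_prod_beta indicator_def mem_ball by measurable
  have "(\<integral>\<^sup>+x. ball_avg r f x \<partial>M) = (\<integral>\<^sup>+x. \<integral>\<^sup>+y. f y * \<kappa> x y / emeasure M (ball x r) \<partial>M \<partial>M)"
    unfolding ball_avg_def
  proof (rule nn_integral_cong)
    fix x
    have "(\<integral>\<^sup>+y. f y * \<kappa> x y / emeasure M (ball x r) \<partial>M) = (\<integral>\<^sup>+y. f y * indicator (ball x r) y \<partial>M) / emeasure M (ball x r)"
      by (simp add: \<kappa>_def nn_integral_divide)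
    then show "(\<integral>\<^sup>+y. f y * indicator (ball x r) y \<partial>M) / emeasure M (ball x r) = (\<integral>\<^sup>+y. f y * \<kappa> x y / emeasure M (ball x r) \<partial>M)" ..
  qed
  also have "\<dots> = (\<integral>\<^sup>+y. \<integral>\<^sup>+x. f y * \<kappa> x y / emeasure M (ball x r) \<partial>M \<partial>M)"
    by (rule Fubini') measurable
  also have "\<dots> \<le> (\<integral>\<^sup>+y. ennreal K * f y \<partial>M)"
  proof (rule nn_integral_mono)
    fix y
    have "(\<integral>\<^sup>+x. f y * \<kappa> x y / emeasure M (ball x r) \<partial>M) \<le>
        (\<integral>\<^sup>+x. (f y * ennreal (K / measure M (ball y r))) * indicator (ball y r) x \<partial>M)"
    proof (rule nn_integral_mono)
      fix x
      show "f y * \<kappa> x y / emeasure M (ball x r) \<le> (f y * ennreal (K / measure M (ball y r))) * indicator (ball y r) x"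
      proof (cases "dist x y < r")
        case True
        have "measure M (ball y r) \<le> K * measure M (ball x r)"
          by (rule measure_ball_le_K) (use True assms in auto)
        then have "1 / measure M (ball x r) \<le> K / measure M (ball y r)"
          using measure_ball_pos[OF assms(2)] by (simp add: field_simps)
        then have "1 / emeasure M (ball x r) \<le> ennreal (K / measure M (ball y r))"
          using measure_ball_pos[OF assms(2)] emeasure_ball[OF assms(2)]
          by (simp add: divide_ennreal ennreal_leI flip: ennreal_1)
        then have "f y * (1 / emeasure M (ball x r)) \<le> f y * ennreal (K / measure M (ball y r))"
          by (rule mult_left_mono) simp
        then show ?thesis using True by (simp add: \<kappa>_def dist_commute ennreal_times_divide)
      qed (simp add: \<kappa>_def)
    qed
    also have "\<dots> = f y * (ennreal (K / measure M (ball y r)) * emeasure M (ball y r))"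
      by (subst nn_integral_cmult_indicator) (auto simp: mult.assoc)
    also have "ennreal (K / measure M (ball y r)) * emeasure M (ball y r) = ennreal K"
      using measure_ball_pos[OF assms(2), of y] K_ge_1
      by (simp add: emeasure_ball[OF assms(2)] ennreal_mult[symmetric])
    finally show "(\<integral>\<^sup>+x. f y * \<kappa> x y / emeasure M (ball x r) \<partial>M) \<le> ennreal K * f y"
      by (simp add: mult.commute)
  qed
  also have "\<dots> = ennreal K * (\<integral>\<^sup>+x. f x \<partial>M)" by (rule nn_integral_cmult) measurable
  finally show ?thesis .
qed

end

section \<open>Mollification\<close>

text \<open>
  With \<open>a\<close> optimised after integration this serves as a substitute for Hoelder's inequality.
\<close>

lemma powr_inverse_le_add:
  fixes t a p :: real
  assumes "1 < p" "0 \<le> t" "0 < a"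
  shows "t powr (1 / p) \<le> a + a powr (1 - p) * t"
proof (cases "t powr (1 / p) \<le> a")
  case True
  then show ?thesis using assms by (simp add: add_increasing2)
next
  case False
  define s where "s = t powr (1 / p)"
  have s: "a < s" "t = s powr p" using False assms by (auto simp: s_def powr_powr)
  have "s = s powr (1 - p) * s powr p" using s assms by (simp add: powr_add[symmetric])
  also have "\<dots> \<le> a powr (1 - p) * s powr p"
    by (intro mult_right_mono powr_mono2') (use s assms in auto)
  finally have "s \<le> a powr (1 - p) * t" by (simp only: s(2)[symmetric])
  then show ?thesis unfolding s_def using assms(3) by linarith
qed

section \<open>Set integrals over balls\<close>

context doubling_mms
begin

lemma set_integrable_const_ball [simp]: "set_integrable M (ball x r) (\<lambda>_. c :: real)"
  using fmeasurable_ball[of x r] by (auto simp: set_integrable_def fmeasurable_def)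

lemma set_integral_const_ball [simp]: "(LINT y:ball x r|M. c) = c * measure M (ball x r)" for c :: real
  by (simp add: set_lebesgue_integral_def space_M)

lemma set_integrable_ball_of_integrable: "integrable M f \<Longrightarrow> set_integrable M (ball x r) f" for f :: "'a \<Rightarrow> real"
  unfolding set_integrable_def by (rule integrable_mult_indicator) auto

lemma set_integral_abs_le:
  fixes f g :: "'a \<Rightarrow> real"
  assumes "set_integrable M (ball x r) g" "f \<in> borel_measurable M" "AE y\<in>ball x r in M. \<bar>f y\<bar> \<le> g y"
  shows "set_integrable M (ball x r) f" "\<bar>LINT y:ball x r|M. f y\<bar> \<le> (LINT y:ball x r|M. g y)"
proof -
  show f: "set_integrable M (ball x r) f"
    by (rule set_integrable_bound[OF assms(1)])
      (use assms in \<open>auto simp: set_borel_measurable_def elim!: eventually_mono\<close>)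
  have "\<bar>LINT y:ball x r|M. f y\<bar> \<le> (LINT y:ball x r|M. \<bar>f y\<bar>)"
    using set_integral_norm_bound[OF f] by simp
  also have "\<dots> \<le> (LINT y:ball x r|M. g y)"
    by (rule set_integral_mono_AE[OF set_integrable_abs[OF f] assms(1,3)])
  finally show "\<bar>LINT y:ball x r|M. f y\<bar> \<le> (LINT y:ball x r|M. g y)" .
qed

end

text \<open>
  \<open>P powr (1 / p)\<close> plays the role of a Hajlasz gradient multiplied by the scale \<open>r\<close>; \<open>v\<close> below is
  the mollification of \<open>u\<close> by the tent kernel \<open>w\<close>.
\<close>

locale smoothing = doubling_mms M C \<nu> for M :: "'a::metric_space measure" and C \<nu> :: real +
  fixes u P :: "'a \<Rightarrow> real" and p r :: real and E :: "'a set"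
  assumes p: "1 < p" and r: "0 < r"
    and u_integrable: "integrable_on_balls M u"
    and P_nonneg: "\<And>x. 0 \<le> P x" and P_integrable: "integrable M P"
    and E_null: "E \<in> null_sets M"
    and u_bound: "\<And>x y. x \<notin> E \<Longrightarrow> y \<notin> E \<Longrightarrow> dist x y < 6 * r \<Longrightarrow>
      \<bar>u x - u y\<bar> \<le> P x powr (1 / p) + P y powr (1 / p)"
begin

definition S :: "'a \<Rightarrow> real" where "S x = P x powr (1 / p)"

text \<open>A sharp cutoff need not vary continuously with the centre. The tent is 1-Lipschitz in
  \<open>x\<close>, at least \<open>r\<close> on \<open>ball x r\<close>, and zero from distance
  \<open>2 * r\<close> on.\<close>

definition w :: "'a \<Rightarrow> 'a \<Rightarrow> real" where "w x y = max 0 (2 * r - dist x y)"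

definition W :: "'a \<Rightarrow> real" where "W x = (\<integral>y. w x y \<partial>M)"

definition v :: "'a \<Rightarrow> real" where "v x = (\<integral>y. w x y * u y \<partial>M) / W x"

text \<open>Going through \<open>ball_avg\<close> provides Borel measurability and the Fubini bound;
  the conversion to a real loses nothing, because the average is finite
  (\<open>ball_avg_P_eq\<close>).\<close>

definition Q :: "'a \<Rightarrow> real" where "Q x = enn2real (ball_avg (3 * r) (\<lambda>y. ennreal (P y)) x)"

definition q :: "'a \<Rightarrow> real" where "q x = Q x powr (1 / p)"

lemma u_measurable [measurable]: "u \<in> borel_measurable M"
  and u_set_integrable: "set_integrable M (ball x \<rho>) u"
proof -
  show "u \<in> borel_measurable M" using u_integrable by (simp add: integrable_on_balls_def)
  show "set_integrable M (ball x \<rho>) u"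
    using u_integrable by (cases "\<rho> > 0") (auto simp: integrable_on_balls_def ball_empty)
qed

lemma P_measurable [measurable]: "P \<in> borel_measurable M"
  using P_integrable by auto

lemma S_measurable [measurable]: "S \<in> borel_measurable M"
  unfolding S_def[abs_def] by measurable

lemma S_nonneg: "0 \<le> S x" by (simp add: S_def)

lemma S_le: "0 < a \<Longrightarrow> S x \<le> a + a powr (1 - p) * P x"
  unfolding S_def using powr_inverse_le_add[OF p P_nonneg] .

lemma AE_notin_E: "AE x in M. x \<notin> E"
  using E_null by (rule AE_not_in)

lemma P_set_integrable: "set_integrable M (ball x \<rho>) P"
  by (rule set_integrable_ball_of_integrable) (rule P_integrable)

lemma S_set_integrable: "set_integrable M (ball x \<rho>) S"
  and set_integral_S_le: "0 < a \<Longrightarrow>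
    (LINT y:ball x \<rho>|M. S y) \<le> a * measure M (ball x \<rho>) + a powr (1 - p) * (LINT y:ball x \<rho>|M. P y)"
proof -
  have int: "set_integrable M (ball x \<rho>) (\<lambda>y. a + a powr (1 - p) * P y)" for a
    by (intro set_integral_add(1) set_integrable_const_ball set_integrable_mult_right P_set_integrable)
  show S: "set_integrable M (ball x \<rho>) S"
    by (rule set_integral_abs_le(1)[OF int[of 1]]) (use S_le[of 1] S_nonneg in auto)
  assume a: "0 < a"
  have "(LINT y:ball x \<rho>|M. S y) \<le> (LINT y:ball x \<rho>|M. a + a powr (1 - p) * P y)"
    by (rule set_integral_mono[OF S int]) (rule S_le[OF a])
  also have "\<dots> = a * measure M (ball x \<rho>) + a powr (1 - p) * (LINT y:ball x \<rho>|M. P y)"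
    by (subst set_integral_add(2)) (auto intro: P_set_integrable)
  finally show "(LINT y:ball x \<rho>|M. S y) \<le>
      a * measure M (ball x \<rho>) + a powr (1 - p) * (LINT y:ball x \<rho>|M. P y)" .
qed

lemma Q_eq: "Q x = (LINT y:ball x (3 * r)|M. P y) / measure M (ball x (3 * r))"
proof -
  have "(\<integral>\<^sup>+y\<in>ball x (3 * r). ennreal (P y) \<partial>M) = (\<integral>\<^sup>+y. ennreal (indicator (ball x (3 * r)) y *\<^sub>R P y) \<partial>M)"
    by (rule nn_integral_cong) (auto split: split_indicator)
  also have "\<dots> = ennreal (LINT y:ball x (3 * r)|M. P y)"
    unfolding set_lebesgue_integral_def
    by (rule nn_integral_eq_integral)
      (use P_set_integrable P_nonneg in \<open>auto simp: set_integrable_def\<close>)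
  finally have eq: "(\<integral>\<^sup>+y\<in>ball x (3 * r). ennreal (P y) \<partial>M) = ennreal (LINT y:ball x (3 * r)|M. P y)" .
  have "0 \<le> (LINT y:ball x (3 * r)|M. P y)"
    unfolding set_lebesgue_integral_def by (rule integral_nonneg_AE) (use P_nonneg in auto)
  then show ?thesis
    unfolding Q_def ball_avg_def eq
    using r measure_ball_pos[of "3 * r" x] by (simp add: emeasure_ball divide_ennreal)
qed

lemma Q_nonneg: "0 \<le> Q x" by (simp add: Q_def)

lemma q_nonneg: "0 \<le> q x" by (simp add: q_def)

lemma q_powr: "q x powr p = Q x"
  using p Q_nonneg by (simp add: q_def powr_powr)

lemma Q_borel [measurable]: "Q \<in> borel_measurable borel"
proof -
  have "ball_avg (3 * r) (\<lambda>y. ennreal (P y)) \<in> borel_measurable borel"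
    by (rule borel_measurable_ball_avg) measurable
  then show ?thesis unfolding Q_def[abs_def] by measurable
qed

lemma q_borel [measurable]: "q \<in> borel_measurable borel"
  unfolding q_def[abs_def] by measurable

lemma ball_avg_P_eq: "ball_avg (3 * r) (\<lambda>y. ennreal (P y)) x = ennreal (Q x)"
proof -
  have "(\<integral>\<^sup>+y\<in>ball x (3 * r). ennreal (P y) \<partial>M) \<le> (\<integral>\<^sup>+y. ennreal (P y) \<partial>M)"
    by (rule nn_integral_mono) (auto split: split_indicator)
  also have "\<dots> < \<infinity>" using integrableD(2)[OF P_integrable] P_nonneg by (simp add: less_top)
  finally have "ball_avg (3 * r) (\<lambda>y. ennreal (P y)) x < top"
    using r measure_ball_pos[of "3 * r" x]
    by (simp add: ball_avg_def emeasure_ball less_top[symmetric] ennreal_divide_eq_top_iff)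
  then show ?thesis by (simp add: Q_def)
qed

lemma nn_integral_Q_le: "(\<integral>\<^sup>+x. ennreal (Q x) \<partial>M) \<le> ennreal (K * (\<integral>x. P x \<partial>M))"
proof -
  have "(\<integral>\<^sup>+x. ennreal (Q x) \<partial>M) \<le> ennreal K * (\<integral>\<^sup>+x. ennreal (P x) \<partial>M)"
    using nn_integral_ball_avg_le[of "\<lambda>y. ennreal (P y)" "3 * r"] r by (simp add: ball_avg_P_eq)
  also have "(\<integral>\<^sup>+x. ennreal (P x) \<partial>M) = ennreal (\<integral>x. P x \<partial>M)"
    by (rule nn_integral_eq_integral) (use P_integrable P_nonneg in auto)
  finally show ?thesis using K_ge_1 P_nonneg by (simp add: ennreal_mult integral_nonneg_AE)
qed

lemma Q_integrable: "integrable M Q" and integral_Q_le: "(\<integral>x. Q x \<partial>M) \<le> K * (\<integral>x. P x \<partial>M)"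
proof -
  have [measurable]: "Q \<in> borel_measurable M" by (rule borel_measurable_M) measurable
  show Q: "integrable M Q"
    by (rule integrableI_nonneg)
      (use nn_integral_Q_le Q_nonneg in \<open>auto intro: le_less_trans simp del: ennreal_mult\<close>)
  have "ennreal (\<integral>x. Q x \<partial>M) \<le> ennreal (K * (\<integral>x. P x \<partial>M))"
    using nn_integral_Q_le nn_integral_eq_integral[OF Q] Q_nonneg by simp
  then show "(\<integral>x. Q x \<partial>M) \<le> K * (\<integral>x. P x \<partial>M)"
    using K_ge_1 P_nonneg by (subst (asm) ennreal_le_iff) (auto simp: integral_nonneg_AE)
qed

lemma q_le: "0 < a \<Longrightarrow> q x \<le> a + a powr (1 - p) * Q x"
  unfolding q_def using powr_inverse_le_add[OF p Q_nonneg] .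

section \<open>Oscillation of u on a ball, controlled by q\<close>

text \<open>With \<open>a\<close> above \<open>q z\<close> both terms of
  \<open>set_integral_S_le\<close> are at most \<open>a\<close> times the measure, as
  \<open>a powr (1 - p) * a powr p = a\<close>. A strictly larger \<open>a\<close> is used instead
  of \<open>q z\<close> itself, which may be zero.\<close>

lemma set_integral_S_le_of_q_less:
  assumes "q z < a"
  shows "(LINT y:ball z (3 * r)|M. S y) \<le> 2 * a * measure M (ball z (3 * r))"
proof -
  let ?m = "measure M (ball z (3 * r))"
  have m: "?m > 0" using r by (intro measure_ball_pos) simp
  have a: "a > 0" using assms q_nonneg[of z] by linarith
  have "Q z \<le> a powr p" using assms q_powr[of z] q_nonneg[of z] p
    by (metis less_eq_real_def order_less_trans powr_mono2 zero_less_one)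
  then have "a powr (1 - p) * Q z \<le> a powr (1 - p) * a powr p" by (intro mult_left_mono) auto
  also have "\<dots> = a" using a by (simp add: powr_add[symmetric])
  finally have *: "a powr (1 - p) * Q z * ?m \<le> a * ?m" using m by (intro mult_right_mono) auto
  have "(LINT y:ball z (3 * r)|M. P y) = Q z * ?m" using m by (simp add: Q_eq)
  with set_integral_S_le[OF a, of z "3 * r"] * show ?thesis by (simp add: algebra_simps)
qed

text \<open>Chebyshev: the mean of \<open>S\<close> is at most \<open>2 * a\<close>, so
  \<open>S\<close> cannot exceed \<open>3 * a\<close> almost everywhere on the ball.\<close>

lemma exists_S_le:
  assumes "q z < a"
  shows "\<exists>y\<in>ball z (3 * r) - E. S y \<le> 3 * a"
proof (rule ccontr)
  assume "\<not> ?thesis"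
  then have *: "3 * a < S y" if "y \<in> ball z (3 * r)" "y \<notin> E" for y using that by (auto simp: not_le)
  let ?m = "measure M (ball z (3 * r))"
  have m: "?m > 0" using r by (intro measure_ball_pos) simp
  have a: "a > 0" using assms q_nonneg[of z] by linarith
  have "3 * a * ?m = (LINT y:ball z (3 * r)|M. 3 * a)" by simp
  also have "\<dots> \<le> (LINT y:ball z (3 * r)|M. S y)"
    by (rule set_integral_mono_AE[OF set_integrable_const_ball S_set_integrable])
      (use AE_notin_E * in \<open>auto elim!: eventually_mono intro: less_imp_le\<close>)
  also have "\<dots> \<le> 2 * a * ?m" by (rule set_integral_S_le_of_q_less[OF assms])
  finally show False using m a by simp
qed

lemma u_diff_set_integrable: "set_integrable M (ball z \<rho>) (\<lambda>y. \<bar>u y - c\<bar>)"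
  by (intro set_integrable_abs set_integral_diff u_set_integrable set_integrable_const_ball)

text \<open>Take for \<open>c\<close> the value of \<open>u\<close> at a point from
  \<open>exists_S_le\<close>. Any two points of the ball are less than \<open>6 * r\<close> apart,
  so \<open>u_bound\<close> applies; the 5 is 2 from the mean of \<open>S\<close> plus 3 from that
  point.\<close>

lemma mean_oscillation_le:
  assumes "q z < a"
  shows "\<exists>c. (LINT y:ball z (3 * r)|M. \<bar>u y - c\<bar>) \<le> 5 * a * measure M (ball z (3 * r))"
proof -
  obtain y0 where y0: "y0 \<in> ball z (3 * r)" "y0 \<notin> E" "S y0 \<le> 3 * a"
    using exists_S_le[OF assms] by blast
  have "(LINT y:ball z (3 * r)|M. \<bar>u y - u y0\<bar>) \<le> (LINT y:ball z (3 * r)|M. S y + 3 * a)"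
  proof (rule set_integral_mono_AE[OF u_diff_set_integrable])
    show "set_integrable M (ball z (3 * r)) (\<lambda>y. S y + 3 * a)"
      by (intro set_integral_add S_set_integrable set_integrable_const_ball)
    show "AE y\<in>ball z (3 * r) in M. \<bar>u y - u y0\<bar> \<le> S y + 3 * a"
      using AE_notin_E
    proof eventually_elim
      case (elim y)
      show ?case
      proof
        assume "y \<in> ball z (3 * r)"
        then have "dist y y0 < 6 * r" using y0(1) dist_triangle[of y y0 z] by (simp add: dist_commute)
        from u_bound[OF elim y0(2) this] y0(3) show "\<bar>u y - u y0\<bar> \<le> S y + 3 * a" by (simp add: S_def)
      qed
    qed
  qed
  also have "\<dots> = (LINT y:ball z (3 * r)|M. S y) + 3 * a * measure M (ball z (3 * r))"
    by (subst set_integral_add(2)) (auto intro: S_set_integrable)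
  also have "\<dots> \<le> 5 * a * measure M (ball z (3 * r))"
    using set_integral_S_le_of_q_less[OF assms] by (simp add: algebra_simps)
  finally show ?thesis by blast
qed

section \<open>The tent kernel and the Lipschitz bound for the mollification\<close>

lemma w_nonneg: "0 \<le> w x y" and w_le: "w x y \<le> 2 * r"
  and w_eq_0: "2 * r \<le> dist x y \<Longrightarrow> w x y = 0"
  and w_ge: "dist x y < r \<Longrightarrow> r \<le> w x y"
  using r by (auto simp: w_def)

lemma w_lipschitz: "\<bar>w x y - w x' y\<bar> \<le> dist x x'"
  unfolding w_def using dist_triangle[of x y x'] dist_triangle[of x' y x]
  by (auto simp: dist_commute max_def)

lemma w_measurable [measurable]: "w x \<in> borel_measurable M"
  unfolding w_def[abs_def]
  by (intro borel_measurable_M borel_measurable_continuous_onI continuous_intros)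

text \<open>Provides a common domain of integration for all centres near \<open>z\<close>, so that
  their mollifications can be compared.\<close>

lemma integral_w_eq:
  assumes "dist z x \<le> r"
  shows "(\<integral>y. w x y * f y \<partial>M) = (LINT y:ball z (3 * r)|M. w x y * f y)"
  unfolding set_lebesgue_integral_def
proof (rule Bochner_Integration.integral_cong)
  fix y
  have "w x y = 0" if "y \<notin> ball z (3 * r)"
    using that assms dist_triangle[of z y x] by (intro w_eq_0) auto
  then show "w x y * f y = indicator (ball z (3 * r)) y *\<^sub>R (w x y * f y)"
    by (auto split: split_indicator)
qed simp

lemma w_mult_set_integrable:
  assumes f: "set_integrable M (ball z \<rho>) f" and [measurable]: "f \<in> borel_measurable M"
  shows "set_integrable M (ball z \<rho>) (\<lambda>y. w x y * f y)"
proof (rule set_integral_abs_le(1))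
  show "set_integrable M (ball z \<rho>) (\<lambda>y. 2 * r * \<bar>f y\<bar>)"
    by (intro set_integrable_mult_right set_integrable_abs f)
  show "AE y\<in>ball z \<rho> in M. \<bar>w x y * f y\<bar> \<le> 2 * r * \<bar>f y\<bar>"
    using w_nonneg w_le by (auto simp: abs_mult intro!: mult_right_mono)
qed measurable

lemma W_eq: "dist z x \<le> r \<Longrightarrow> W x = (LINT y:ball z (3 * r)|M. w x y)"
  using integral_w_eq[of z x "\<lambda>_. 1"] by (simp add: W_def)

lemma w_set_integrable: "set_integrable M (ball z \<rho>) (w x)"
  using w_mult_set_integrable[of z \<rho> "\<lambda>_. 1" x] by simp

lemma W_ge:
  assumes "dist z x \<le> r"
  shows "r * measure M (ball z (3 * r)) / K \<le> W x"
proof -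
  have "measure M (ball z (3 * r)) \<le> K * measure M (ball x r)"
    by (rule measure_ball_le_K) (use r assms in \<open>auto simp: dist_commute\<close>)
  then have "r * measure M (ball z (3 * r)) / K \<le> r * measure M (ball x r)"
    using r K_ge_1 by (simp add: field_simps)
  also have "\<dots> = (LINT y:ball x r|M. r)" by simp
  also have "\<dots> \<le> (LINT y:ball x r|M. w x y)"
    by (rule set_integral_mono[OF set_integrable_const_ball w_set_integrable]) (use w_ge in auto)
  also have "\<dots> \<le> (LINT y:ball x (3 * r)|M. w x y)"
    unfolding set_lebesgue_integral_def
    by (rule integral_mono)
      (use w_set_integrable r w_nonneg in \<open>auto simp: set_integrable_def split: split_indicator\<close>)
  also have "\<dots> = W x" using r by (intro W_eq[symmetric]) simp
  finally show ?thesis .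
qed

lemma W_pos: "0 < W x"
proof -
  have "0 < r * measure M (ball x (3 * r)) / K"
    using r K_ge_1 measure_ball_pos[of "3 * r" x] by simp
  also have "\<dots> \<le> W x" using r by (intro W_ge) simp
  finally show ?thesis .
qed

text \<open>The normalisation by \<open>W\<close> makes the mollification reproduce constants, so
  only the oscillation of \<open>u\<close> matters.\<close>

lemma v_minus_const_eq:
  assumes "dist z x \<le> r"
  shows "v x - c = (LINT y:ball z (3 * r)|M. w x y * (u y - c)) / W x"
proof -
  have "(LINT y:ball z (3 * r)|M. w x y * (u y - c)) =
      (LINT y:ball z (3 * r)|M. w x y * u y - c * w x y)"
    by (rule set_lebesgue_integral_cong) (auto simp: algebra_simps)
  also have "\<dots> = (LINT y:ball z (3 * r)|M. w x y * u y) - c * W x"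
    by (subst set_integral_diff(2))
      (auto intro!: w_mult_set_integrable u_set_integrable w_set_integrable simp: W_eq[OF assms])
  finally have "(LINT y:ball z (3 * r)|M. w x y * (u y - c)) = v x * W x - c * W x"
    using W_pos[of x] by (simp add: v_def integral_w_eq[OF assms])
  then show ?thesis using W_pos[of x] by (simp add: field_simps)
qed

text \<open>A quotient estimate for \<open>F / W\<close>: moving the centre by \<open>d\<close>
  changes numerator and denominator by at most \<open>d * A\<close> and \<open>d * m\<close>, and
  both denominators are at least \<open>r * m / K\<close>.\<close>

lemma v_lipschitz_of_q_less:
  assumes "q z < a" "dist z x \<le> r" "dist z x' \<le> r"
  shows "\<bar>v x - v x'\<bar> \<le> dist x x' * (15 * K\<^sup>2 / r * a)"
proof -
  let ?B = "ball z (3 * r)"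
  define m where "m = measure M ?B"
  have m: "m > 0" unfolding m_def using r by (intro measure_ball_pos) simp
  have a: "a > 0" using assms q_nonneg[of z] by linarith
  have K0: "K > 0" using K_ge_1 by simp
  obtain c where c: "(LINT y:?B|M. \<bar>u y - c\<bar>) \<le> 5 * a * m"
    using mean_oscillation_le[OF assms(1)] by (auto simp: m_def)
  define A where "A = (LINT y:?B|M. \<bar>u y - c\<bar>)"
  define d where "d = dist x x'"
  define F where "F x = (LINT y:?B|M. w x y * (u y - c))" for x
  have int: "set_integrable M ?B (\<lambda>y. w x y * (u y - c))" for x
    by (intro w_mult_set_integrable set_integral_diff u_set_integrable set_integrable_const_ball) measurable
  have A0: "0 \<le> A" unfolding A_def set_lebesgue_integral_def by (rule integral_nonneg_AE) auto
  have F1: "\<bar>F x - F x'\<bar> \<le> d * A"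
  proof -
    have "F x - F x' = (LINT y:?B|M. w x y * (u y - c) - w x' y * (u y - c))"
      unfolding F_def by (subst set_integral_diff(2)[OF int int]) simp
    also have "\<bar>\<dots>\<bar> \<le> (LINT y:?B|M. d * \<bar>u y - c\<bar>)"
    proof (rule set_integral_abs_le(2))
      show "set_integrable M ?B (\<lambda>y. d * \<bar>u y - c\<bar>)"
        by (intro set_integrable_mult_right u_diff_set_integrable)
      show "AE y\<in>?B in M. \<bar>w x y * (u y - c) - w x' y * (u y - c)\<bar> \<le> d * \<bar>u y - c\<bar>"
        using w_lipschitz[of x _ x']
        by (auto simp: left_diff_distrib[symmetric] abs_mult d_def intro!: mult_right_mono)
    qed measurable
    finally show ?thesis by (simp add: A_def)
  qed
  have F2: "\<bar>F x'\<bar> \<le> 2 * r * A"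
  proof -
    have "\<bar>F x'\<bar> \<le> (LINT y:?B|M. 2 * r * \<bar>u y - c\<bar>)"
      unfolding F_def
    proof (rule set_integral_abs_le(2))
      show "set_integrable M ?B (\<lambda>y. 2 * r * \<bar>u y - c\<bar>)"
        by (intro set_integrable_mult_right u_diff_set_integrable)
      show "AE y\<in>?B in M. \<bar>w x' y * (u y - c)\<bar> \<le> 2 * r * \<bar>u y - c\<bar>"
        using w_nonneg w_le by (auto simp: abs_mult intro!: mult_right_mono)
    qed measurable
    then show ?thesis by (simp add: A_def)
  qed
  have W1: "\<bar>W x' - W x\<bar> \<le> d * m"
  proof -
    have "W x' - W x = (LINT y:?B|M. w x' y - w x y)"
      unfolding W_eq[OF assms(2)] W_eq[OF assms(3)]
      by (subst set_integral_diff(2)[OF w_set_integrable w_set_integrable]) simp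
    also have "\<bar>\<dots>\<bar> \<le> (LINT y:?B|M. d)"
      by (rule set_integral_abs_le(2)[OF set_integrable_const_ball])
        (use w_lipschitz[of x' _ x] in \<open>auto simp: d_def dist_commute\<close>)
    finally show ?thesis by (simp add: m_def)
  qed
  have W2: "r * m / K \<le> W x" "r * m / K \<le> W x'"
    unfolding m_def using W_ge assms by auto
  have rmK: "0 < r * m / K" using r m K0 by simp
  have "v x - v x' = F x / W x - F x' / W x'"
    using v_minus_const_eq[OF assms(2), of c] v_minus_const_eq[OF assms(3), of c] by (simp add: F_def)
  also have "\<dots> = (F x - F x') / W x + F x' * (W x' - W x) / (W x * W x')"
    using W_pos[of x] W_pos[of x'] by (simp add: field_simps)
  also have "\<bar>\<dots>\<bar> \<le> \<bar>(F x - F x') / W x\<bar> + \<bar>F x' * (W x' - W x) / (W x * W x')\<bar>"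
    by (rule abs_triangle_ineq)
  also have "\<dots> = \<bar>F x - F x'\<bar> / W x + \<bar>F x'\<bar> * \<bar>W x' - W x\<bar> / (W x * W x')"
    using W_pos[of x] W_pos[of x'] by (simp add: abs_mult)
  also have "\<dots> \<le> d * A / (r * m / K) + 2 * r * A * (d * m) / ((r * m / K) * (r * m / K))"
    using F1 F2 W1 W2 rmK A0 m r K0 W_pos[of x, THEN less_imp_le] W_pos[of x', THEN less_imp_le]
    by (intro add_mono frac_le mult_mono mult_nonneg_nonneg) (auto simp: d_def)
  also have "2 * r * A * (d * m) / ((r * m / K) * (r * m / K)) = d * A / (r * m) * (2 * K\<^sup>2)"
    using r m K0 by (simp add: field_simps power2_eq_square)
  also have "d * A / (r * m / K) + d * A / (r * m) * (2 * K\<^sup>2) = d * A / (r * m) * (K + 2 * K\<^sup>2)"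
    by (simp add: distrib_left)
  \<comment> \<open>The 15 is the 5 of \<open>mean_oscillation_le\<close> times the 3 left after
    absorbing \<open>K\<close> into its square.\<close>
  also have "\<dots> \<le> d * (5 * a * m) / (r * m) * (3 * K\<^sup>2)"
  proof (intro mult_mono divide_right_mono mult_left_mono)
    show "A \<le> 5 * a * m" using c by (simp add: A_def)
    show "K + 2 * K\<^sup>2 \<le> 3 * K\<^sup>2" using K_ge_1 by (simp add: power2_eq_square)
  qed (use r m A0 a K0 in \<open>auto simp: d_def\<close>)
  also have "\<dots> = dist x x' * (15 * K\<^sup>2 / r * a)"
    using m r by (simp add: d_def field_simps)
  finally show ?thesis .
qed

text \<open>The Lipschitz constant of \<open>v_lipschitz_of_q_less\<close> in the limit where
  \<open>a\<close> decreases to \<open>q x\<close>.\<close>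

definition h :: "'a \<Rightarrow> real" where "h x = 15 * K\<^sup>2 / r * q x"

lemma v_lipschitz:
  assumes "dist z x \<le> r" "dist z x' \<le> r"
  shows "\<bar>v x - v x'\<bar> \<le> dist x x' * h z"
proof (rule field_le_epsilon)
  fix e :: real assume e: "e > 0"
  \<comment> \<open>The coefficient of \<open>a\<close> in the bound; dividing by
    \<open>b + 1\<close> stays legitimate when \<open>x = x'\<close>.\<close>
  define b where "b = dist x x' * (15 * K\<^sup>2 / r)"
  have b: "0 \<le> b" using r by (simp add: b_def)
  have "\<bar>v x - v x'\<bar> \<le> dist x x' * (15 * K\<^sup>2 / r * (q z + e / (b + 1)))"
    by (rule v_lipschitz_of_q_less) (use assms e b in auto)
  also have "\<dots> = dist x x' * h z + b * (e / (b + 1))"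
    by (simp add: h_def b_def algebra_simps)
  also have "b * (e / (b + 1)) \<le> e" using b e by (simp add: field_simps)
  finally show "\<bar>v x - v x'\<bar> \<le> dist x x' * h z + e" by simp
qed

lemma h_nonneg: "0 \<le> h x"
  using r q_nonneg by (simp add: h_def)

lemma h_upper_gradient: "weak_upper_gradient M p' v h"
proof (rule weak_upper_gradient_of_local_bound[OF r])
  show "h \<in> borel_measurable borel" unfolding h_def[abs_def] by measurable
qed (use v_lipschitz h_nonneg in auto)

lemma v_measurable [measurable]: "v \<in> borel_measurable M"
proof (intro borel_measurable_M borel_measurable_continuous_onI)
  show "continuous_on UNIV v"
    unfolding continuous_on_iff
  proof (intro ballI allI impI)
    fix x and e :: real assume e: "e > 0"
    show "\<exists>d>0. \<forall>x'\<in>UNIV. dist x' x < d \<longrightarrow> dist (v x') (v x) < e"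
    proof (intro exI[of _ "min r (e / (h x + 1))"] conjI ballI impI)
      show "0 < min r (e / (h x + 1))" using r e h_nonneg[of x] by simp
      fix x' assume d: "dist x' x < min r (e / (h x + 1))"
      have "dist (v x') (v x) \<le> dist x' x * h x"
        unfolding dist_real_def by (rule v_lipschitz) (use d r in \<open>auto simp: dist_commute\<close>)
      also have "\<dots> \<le> dist x' x * (h x + 1)" by (intro mult_left_mono) auto
      also have "\<dots> < e" using d h_nonneg[of x] by (simp add: field_simps)
      finally show "dist (v x') (v x) < e" .
    qed
  qed
qed

text \<open>\<open>v x - u x\<close> is a weighted mean of \<open>u y - u x\<close>, which is at
  most \<open>S y + S x\<close> for almost every \<open>y\<close>. The quotient of
  \<open>w \<le> 2 * r\<close> by the lower bound on \<open>W\<close> produces the factor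
  \<open>2 * K\<close>.\<close>

lemma v_minus_u_le:
  assumes "x \<notin> E"
  shows "\<bar>v x - u x\<bar> \<le> 2 * K * (2 * q x + S x)"
proof (rule field_le_epsilon)
  fix e :: real assume "e > 0"
  \<comment> \<open>The excess over \<open>q x\<close> enters with factor \<open>4 * K\<close> and
    so contributes exactly \<open>e\<close>.\<close>
  define a where "a = q x + e / (4 * K)"
  have K0: "K > 0" using K_ge_1 by simp
  have a: "q x < a" using \<open>e > 0\<close> K0 by (simp add: a_def)
  let ?B = "ball x (3 * r)"
  define m where "m = measure M ?B"
  have m: "m > 0" unfolding m_def using r by (intro measure_ball_pos) simp
  have a0: "a > 0" using a q_nonneg[of x] by linarith
  have "\<bar>LINT y:?B|M. w x y * (u y - u x)\<bar> \<le> (LINT y:?B|M. 2 * r * (S y + S x))"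
  proof (rule set_integral_abs_le(2))
    show "set_integrable M ?B (\<lambda>y. 2 * r * (S y + S x))"
      by (intro set_integrable_mult_right set_integral_add S_set_integrable set_integrable_const_ball)
    show "AE y\<in>?B in M. \<bar>w x y * (u y - u x)\<bar> \<le> 2 * r * (S y + S x)"
      using AE_notin_E
    proof eventually_elim
      case (elim y)
      show ?case
      proof
        assume "y \<in> ?B"
        then have "\<bar>u y - u x\<bar> \<le> S y + S x"
          unfolding S_def by (intro u_bound elim assms) (use r in \<open>auto simp: dist_commute\<close>)
        then show "\<bar>w x y * (u y - u x)\<bar> \<le> 2 * r * (S y + S x)"
          unfolding abs_mult using w_nonneg[of x y] w_le[of x y] r by (intro mult_mono) auto
      qed
    qed
  qed measurable
  also have "\<dots> = 2 * r * ((LINT y:?B|M. S y) + S x * m)"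
    by (simp add: set_integral_add(2)[OF S_set_integrable set_integrable_const_ball] m_def)
  also have "\<dots> \<le> 2 * r * (2 * a * m + S x * m)"
    using set_integral_S_le_of_q_less[OF a] r by (simp add: m_def)
  finally have 1: "\<bar>LINT y:?B|M. w x y * (u y - u x)\<bar> \<le> 2 * r * (2 * a * m + S x * m)" .
  have "\<bar>v x - u x\<bar> = \<bar>LINT y:?B|M. w x y * (u y - u x)\<bar> / W x"
    using v_minus_const_eq[of x x "u x"] r W_pos[of x] by (simp add: abs_divide)
  also have "\<dots> \<le> 2 * r * (2 * a * m + S x * m) / (r * m / K)"
    using 1 W_ge[of x x] r m K0 a0 S_nonneg[of x] by (intro frac_le) (auto simp: m_def)
  also have "\<dots> = 2 * K * (2 * a + S x)" using r m K0 by (simp add: field_simps)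
  also have "\<dots> = 2 * K * (2 * q x + S x) + e" using K0 by (simp add: a_def field_simps)
  finally show "\<bar>v x - u x\<bar> \<le> 2 * K * (2 * q x + S x) + e" .
qed

end

section \<open>Vanishing mean oscillation\<close>

lemma ennpowr_ennreal: "0 \<le> x \<Longrightarrow> ennpowr (ennreal x) p = ennreal (x powr p)"
  by (simp add: ennpowr_def)

lemma ennpowr_mono:
  assumes "x \<le> y" "0 \<le> p"
  shows "ennpowr x p \<le> ennpowr y p"
proof (cases "y = top")
  case False
  then have "x \<noteq> top" using assms(1) by (auto simp: top_unique)
  moreover have "enn2real x \<le> enn2real y"
    using assms(1) False by (intro enn2real_mono) (auto simp: less_top)
  ultimately show ?thesis using False assms by (auto simp: ennpowr_def intro!: ennreal_leI powr_mono2)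
qed (simp add: ennpowr_def)

lemma (in doubling_mms) set_integral_le_integral:
  fixes f :: "'a \<Rightarrow> real"
  assumes "integrable M f" "\<And>x. 0 \<le> f x"
  shows "(LINT x:ball z \<rho>|M. f x) \<le> (\<integral>x. f x \<partial>M)"
  unfolding set_lebesgue_integral_def
  using set_integrable_ball_of_integrable[OF assms(1), of z \<rho>] assms
  by (intro integral_mono) (auto simp: set_integrable_def split: split_indicator)

section \<open>Integral estimates for the mollification on a ball\<close>

context smoothing
begin

lemma q_set_integrable: "set_integrable M (ball x \<rho>) q"
  and set_integral_q_le: "0 < a \<Longrightarrow>
    (LINT y:ball x \<rho>|M. q y) \<le> a * measure M (ball x \<rho>) + a powr (1 - p) * (\<integral>y. Q y \<partial>M)"
proof -
  have [measurable]: "q \<in> borel_measurable M" by (rule borel_measurable_M) measurable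
  have Q: "set_integrable M (ball x \<rho>) Q" by (rule set_integrable_ball_of_integrable) (rule Q_integrable)
  have int: "set_integrable M (ball x \<rho>) (\<lambda>y. a + a powr (1 - p) * Q y)" for a
    by (intro set_integral_add(1) set_integrable_const_ball set_integrable_mult_right Q)
  show q: "set_integrable M (ball x \<rho>) q"
    by (rule set_integral_abs_le(1)[OF int[of 1]]) (use q_le[of 1] q_nonneg in auto)
  assume a: "0 < a"
  have "(LINT y:ball x \<rho>|M. q y) \<le> (LINT y:ball x \<rho>|M. a + a powr (1 - p) * Q y)"
    by (rule set_integral_mono[OF q int]) (rule q_le[OF a])
  also have "\<dots> = a * measure M (ball x \<rho>) + a powr (1 - p) * (LINT y:ball x \<rho>|M. Q y)"
    by (subst set_integral_add(2)) (auto intro: Q)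
  also have "\<dots> \<le> a * measure M (ball x \<rho>) + a powr (1 - p) * (\<integral>y. Q y \<partial>M)"
    by (intro add_left_mono mult_left_mono set_integral_le_integral Q_integrable Q_nonneg) auto
  finally show "(LINT y:ball x \<rho>|M. q y) \<le> a * measure M (ball x \<rho>) + a powr (1 - p) * (\<integral>y. Q y \<partial>M)" .
qed

lemma majorant_set_integrable: "set_integrable M (ball x \<rho>) (\<lambda>y. 2 * K * (2 * q y + S y))"
  by (intro set_integrable_mult_right set_integral_add q_set_integrable S_set_integrable)

lemma AE_v_minus_u_le: "AE x in M. \<bar>v x - u x\<bar> \<le> 2 * K * (2 * q x + S x)"
  using AE_notin_E by eventually_elim (rule v_minus_u_le)

lemma v_integrable_on_balls: "integrable_on_balls M v"
  unfolding integrable_on_balls_def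
proof (intro conjI allI impI v_measurable)
  fix x \<rho>
  show "set_integrable M (ball x \<rho>) v"
  proof (rule set_integral_abs_le(1))
    show "set_integrable M (ball x \<rho>) (\<lambda>y. \<bar>u y\<bar> + 2 * K * (2 * q y + S y))"
      by (intro set_integral_add(1) set_integrable_abs u_set_integrable majorant_set_integrable)
    show "AE y\<in>ball x \<rho> in M. \<bar>v y\<bar> \<le> \<bar>u y\<bar> + 2 * K * (2 * q y + S y)"
      using AE_v_minus_u_le by eventually_elim auto
  qed measurable
qed

text \<open>The parameter \<open>a\<close> stays free: a small \<open>a\<close> makes the first term
  small, and then a small integral of \<open>P\<close> the second. The 6 is
  \<open>2 * (2 + 1)\<close> from \<open>v_minus_u_le\<close>; \<open>K \<ge> 1\<close> equalises
  the terms.\<close>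

lemma set_integral_v_minus_u_le:
  assumes "0 < a"
  shows "(LINT x:ball z \<rho>|M. \<bar>v x - u x\<bar>) \<le>
    6 * K\<^sup>2 * (a * measure M (ball z \<rho>) + a powr (1 - p) * (\<integral>x. P x \<partial>M))"
proof -
  define m I where "m = measure M (ball z \<rho>)" and "I = (\<integral>x. P x \<partial>M)"
  have I: "0 \<le> I" unfolding I_def using P_nonneg by (simp add: integral_nonneg_AE)
  have KI: "I \<le> K * I" using I K_ge_1 by (simp add: mult_le_cancel_right1)
  have "(LINT x:ball z \<rho>|M. \<bar>v x - u x\<bar>) \<le> (LINT x:ball z \<rho>|M. 2 * K * (2 * q x + S x))"
  proof (rule set_integral_mono_AE[OF _ majorant_set_integrable])
    show "set_integrable M (ball z \<rho>) (\<lambda>x. \<bar>v x - u x\<bar>)"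
      by (rule set_integral_abs_le(1)[OF majorant_set_integrable])
        (use AE_v_minus_u_le in \<open>auto elim!: eventually_mono\<close>)
  qed (use AE_v_minus_u_le in \<open>auto elim!: eventually_mono\<close>)
  also have "\<dots> = 2 * K * (2 * (LINT x:ball z \<rho>|M. q x) + (LINT x:ball z \<rho>|M. S x))"
    by (simp add: set_integral_add(2) q_set_integrable S_set_integrable)
  also have "\<dots> \<le> 2 * K * (2 * (a * m + a powr (1 - p) * (K * I)) + (a * m + a powr (1 - p) * (K * I)))"
  proof (intro mult_left_mono add_mono)
    show "(LINT x:ball z \<rho>|M. q x) \<le> a * m + a powr (1 - p) * (K * I)"
      using set_integral_q_le[OF assms, of z \<rho>] mult_left_mono[OF integral_Q_le, of "a powr (1 - p)"]
      by (simp add: m_def I_def)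
    have "(LINT x:ball z \<rho>|M. P x) \<le> K * I"
      using set_integral_le_integral[OF P_integrable P_nonneg, of z \<rho>] KI by (simp add: I_def)
    from mult_left_mono[OF this, of "a powr (1 - p)"]
    show "(LINT x:ball z \<rho>|M. S x) \<le> a * m + a powr (1 - p) * (K * I)"
      using set_integral_S_le[OF assms, of z \<rho>] by (simp add: m_def)
  qed (use K_ge_1 in auto)
  also have "\<dots> = 6 * K * (1 * (a * m) + K * (a powr (1 - p) * I))"
    by (simp add: algebra_simps)
  also have "\<dots> \<le> 6 * K * (K * (a * m) + K * (a powr (1 - p) * I))"
    by (intro mult_left_mono add_mono mult_right_mono) (use K_ge_1 assms in \<open>auto simp: m_def\<close>)
  also have "\<dots> = 6 * K\<^sup>2 * (a * m + a powr (1 - p) * I)"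
    by (simp add: algebra_simps power2_eq_square)
  finally show ?thesis by (simp add: m_def I_def)
qed

text \<open>The p-th power of \<open>h\<close> is a multiple of \<open>Q / r powr p\<close>, and the
  integral of \<open>Q\<close> is at most \<open>K\<close> times that of \<open>P\<close>. What
  remains is the integral of \<open>P\<close> divided by \<open>r powr p\<close>, the quantity that
  tends to 0.\<close>

lemma h_powr_average_le:
  assumes "0 < \<rho>"
  shows "ennpowr ((\<integral>\<^sup>+y\<in>ball z \<rho>. ennreal (h y powr p) \<partial>M) / emeasure M (ball z \<rho>)) (1 / p) \<le>
    ennreal (15 * K\<^sup>2 * (K * (\<integral>x. P x \<partial>M) / (measure M (ball z \<rho>) * r powr p)) powr (1 / p))"
proof -
  define I m where "I = (\<integral>x. P x \<partial>M)" and "m = measure M (ball z \<rho>)"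
  have m: "m > 0" unfolding m_def by (rule measure_ball_pos) fact
  have I: "0 \<le> I" unfolding I_def using P_nonneg by (simp add: integral_nonneg_AE)
  define b where "b = 15 * K\<^sup>2 / r"
  have b: "b > 0" using r K_ge_1 by (simp add: b_def)
  have [measurable]: "Q \<in> borel_measurable M" using Q_integrable by auto
  have "(\<integral>\<^sup>+y\<in>ball z \<rho>. ennreal (h y powr p) \<partial>M) \<le> (\<integral>\<^sup>+y. ennreal (b powr p) * ennreal (Q y) \<partial>M)"
    by (rule nn_integral_mono)
      (use b Q_nonneg in \<open>auto simp: h_def b_def[symmetric] powr_mult q_nonneg q_powr ennreal_mult split: split_indicator\<close>)
  also have "\<dots> = ennreal (b powr p) * (\<integral>\<^sup>+y. ennreal (Q y) \<partial>M)"
    by (rule nn_integral_cmult) measurable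
  also have "\<dots> \<le> ennreal (b powr p) * ennreal (K * I)"
    unfolding I_def by (intro mult_left_mono nn_integral_Q_le) simp
  also have "\<dots> = ennreal (b powr p * (K * I))" using I K_ge_1 by (simp add: ennreal_mult)
  finally have "(\<integral>\<^sup>+y\<in>ball z \<rho>. ennreal (h y powr p) \<partial>M) / emeasure M (ball z \<rho>) \<le>
      ennreal (b powr p * (K * I)) / ennreal m"
    by (simp add: emeasure_ball[OF assms] m_def divide_right_mono_ennreal)
  also have "\<dots> = ennreal (b powr p * (K * I) / m)"
    using m I K_ge_1 by (intro divide_ennreal) auto
  finally have "ennpowr ((\<integral>\<^sup>+y\<in>ball z \<rho>. ennreal (h y powr p) \<partial>M) / emeasure M (ball z \<rho>)) (1 / p) \<le>
      ennpowr (ennreal (b powr p * (K * I) / m)) (1 / p)"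
    using p by (intro ennpowr_mono) auto
  also have "\<dots> = ennreal ((b powr p * (K * I) / m) powr (1 / p))"
    using m I K_ge_1 by (intro ennpowr_ennreal) auto
  also have "b powr p * (K * I) / m = (15 * K\<^sup>2) powr p * (K * I / (m * r powr p))"
    using r by (simp add: b_def powr_divide)
  also have "\<dots> powr (1 / p) = 15 * K\<^sup>2 * (K * I / (m * r powr p)) powr (1 / p)"
    using p powr_mult[of "(15 * K\<^sup>2) powr p" "K * I / (m * r powr p)" "1 / p"] by (simp add: powr_powr)
  finally show ?thesis by (simp add: I_def m_def)
qed

text \<open>The Poincare inequality is assumed only for the pair \<open>v\<close>, \<open>h\<close>,
  with constants from outside the locale, so that they cannot depend on \<open>r\<close>.\<close>

lemma oscillation_le:
  assumes Cp: "0 < Cp" "1 < l" "0 < \<rho>"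
    and poincare: "ennreal (average M (ball z \<rho>) (\<lambda>y. \<bar>v y - average M (ball z \<rho>) v\<bar>)) \<le>
      ennreal (Cp * \<rho>) * ennpowr ((\<integral>\<^sup>+y\<in>ball z (l * \<rho>). ennreal (h y powr p) \<partial>M)
        / emeasure M (ball z (l * \<rho>))) (1 / p)"
    and a: "0 < a"
  shows "\<exists>c. (LINT x:ball z \<rho>|M. \<bar>u x - c\<bar>) \<le>
    6 * K\<^sup>2 * (a * measure M (ball z \<rho>) + a powr (1 - p) * (\<integral>x. P x \<partial>M)) +
    measure M (ball z \<rho>) * (Cp * \<rho> * (15 * K\<^sup>2 *
      (K * (\<integral>x. P x \<partial>M) / (measure M (ball z (l * \<rho>)) * r powr p)) powr (1 / p)))"
proof (intro exI)
  define c where "c = average M (ball z \<rho>) v"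
  define m where "m = measure M (ball z \<rho>)"
  define X where "X = 15 * K\<^sup>2 *
      (K * (\<integral>x. P x \<partial>M) / (measure M (ball z (l * \<rho>)) * r powr p)) powr (1 / p)"
  have X: "0 \<le> X" by (simp add: X_def)
  have m: "m > 0" unfolding m_def by (rule measure_ball_pos) fact
  have v: "set_integrable M (ball z \<rho>) v"
    using v_integrable_on_balls assms(3) by (simp add: integrable_on_balls_def)
  note vc = set_integrable_abs[OF set_integral_diff(1)[OF v set_integrable_const_ball[of z \<rho> c]]]
  have uv: "set_integrable M (ball z \<rho>) (\<lambda>x. \<bar>v x - u x\<bar>)"
    by (intro set_integrable_abs set_integral_diff v u_set_integrable)
  have "ennreal (average M (ball z \<rho>) (\<lambda>y. \<bar>v y - c\<bar>)) \<le> ennreal (Cp * \<rho>) * ennreal X"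
    unfolding c_def X_def
    by (rule order_trans[OF poincare mult_left_mono[OF h_powr_average_le]]) (use assms in auto)
  then have "average M (ball z \<rho>) (\<lambda>y. \<bar>v y - c\<bar>) \<le> Cp * \<rho> * X"
    using X assms by (simp add: ennreal_mult[symmetric] ennreal_le_iff)
  then have le: "(LINT x:ball z \<rho>|M. \<bar>v x - c\<bar>) \<le> m * (Cp * \<rho> * X)"
    using m by (simp add: average_def m_def field_simps)
  have "(LINT x:ball z \<rho>|M. \<bar>u x - c\<bar>) \<le> (LINT x:ball z \<rho>|M. \<bar>v x - u x\<bar> + \<bar>v x - c\<bar>)"
    by (rule set_integral_mono[OF u_diff_set_integrable set_integral_add(1)[OF uv vc]]) auto
  also have "\<dots> = (LINT x:ball z \<rho>|M. \<bar>v x - u x\<bar>) + (LINT x:ball z \<rho>|M. \<bar>v x - c\<bar>)"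
    by (rule set_integral_add(2)[OF uv vc])
  finally show "(LINT x:ball z \<rho>|M. \<bar>u x - c\<bar>) \<le>
    6 * K\<^sup>2 * (a * measure M (ball z \<rho>) + a powr (1 - p) * (\<integral>x. P x \<partial>M)) +
    measure M (ball z \<rho>) * (Cp * \<rho> * (15 * K\<^sup>2 *
      (K * (\<integral>x. P x \<partial>M) / (measure M (ball z (l * \<rho>)) * r powr p)) powr (1 / p)))"
    using le set_integral_v_minus_u_le[OF a, of z \<rho>] unfolding m_def X_def by linarith
qed

end

section \<open>From vanishing oscillation to constancy\<close>

context doubling_mms
begin

text \<open>The constant \<open>c\<close> may vary with \<open>\<eta>\<close>. Replacing it by the
  mean at most doubles the integral, and the mean no longer depends on
  \<open>\<eta>\<close>.\<close>

lemma AE_eq_const_on_ball: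
  assumes u: "integrable_on_balls M u" and \<rho>: "0 < \<rho>"
    and osc: "\<And>\<eta>. 0 < \<eta> \<Longrightarrow> \<exists>c. (LINT x:ball z \<rho>|M. \<bar>u x - c\<bar>) \<le> \<eta>"
  shows "AE x in M. x \<in> ball z \<rho> \<longrightarrow> u x = average M (ball z \<rho>) u"
proof -
  define m A where "m = measure M (ball z \<rho>)" and "A = average M (ball z \<rho>) u"
  have m: "m > 0" unfolding m_def by (rule measure_ball_pos) fact
  have ui: "set_integrable M (ball z \<rho>) u" using u \<rho> by (simp add: integrable_on_balls_def)
  have [measurable]: "u \<in> borel_measurable M" using u by (simp add: integrable_on_balls_def)
  have int: "set_integrable M (ball z \<rho>) (\<lambda>x. \<bar>u x - c\<bar>)" for c
    by (intro set_integrable_abs set_integral_diff ui set_integrable_const_ball)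
  have "(LINT x:ball z \<rho>|M. \<bar>u x - A\<bar>) \<le> 0"
  proof (rule field_le_epsilon)
    fix e :: real assume "0 < e"
    then obtain c where c: "(LINT x:ball z \<rho>|M. \<bar>u x - c\<bar>) \<le> e / 2" using osc[of "e / 2"] by auto
    have "A * m = (LINT x:ball z \<rho>|M. u x)" using m by (simp add: A_def average_def m_def)
    then have "\<bar>A - c\<bar> * m = \<bar>LINT x:ball z \<rho>|M. u x - c\<bar>"
      using m abs_mult[of "A - c" m]
      by (simp add: set_integral_diff(2)[OF ui set_integrable_const_ball] m_def left_diff_distrib)
    also have "\<dots> \<le> (LINT x:ball z \<rho>|M. \<bar>u x - c\<bar>)"
      by (rule set_integral_abs_le(2)[OF int]) auto
    finally have Ac: "\<bar>A - c\<bar> * m \<le> e / 2" using c by simp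
    have "(LINT x:ball z \<rho>|M. \<bar>u x - A\<bar>) \<le> (LINT x:ball z \<rho>|M. \<bar>u x - c\<bar> + \<bar>A - c\<bar>)"
      by (rule set_integral_mono[OF int set_integral_add(1)[OF int set_integrable_const_ball]]) auto
    also have "\<dots> \<le> 0 + e"
      using Ac c by (simp add: set_integral_add(2)[OF int set_integrable_const_ball] m_def)
    finally show "(LINT x:ball z \<rho>|M. \<bar>u x - A\<bar>) \<le> 0 + e" .
  qed
  moreover have "0 \<le> (LINT x:ball z \<rho>|M. \<bar>u x - A\<bar>)"
    unfolding set_lebesgue_integral_def by (rule integral_nonneg_AE) auto
  ultimately have "(LINT x:ball z \<rho>|M. \<bar>u x - A\<bar>) = 0" by (rule order_antisym)
  then have "(\<integral>x. indicator (ball z \<rho>) x *\<^sub>R \<bar>u x - A\<bar> \<partial>M) = 0"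
    by (simp only: set_lebesgue_integral_def)
  then have "AE x in M. indicator (ball z \<rho>) x *\<^sub>R \<bar>u x - A\<bar> = 0"
    using int[of A] by (subst (asm) integral_nonneg_eq_0_iff_AE) (auto simp: set_integrable_def)
  then show ?thesis unfolding A_def[symmetric] by eventually_elim auto
qed

text \<open>Concentric balls exhaust the space. The smallest has positive measure, hence contains a
  point outside all the null sets; evaluating \<open>u\<close> there identifies the
  constants.\<close>

lemma AE_eq_const_of_balls:
  assumes "\<And>z \<rho>. 0 < \<rho> \<Longrightarrow> \<exists>c. AE x in M. x \<in> ball z \<rho> \<longrightarrow> u x = c"
  shows "\<exists>c. AE x in M. u x = c"
proof -
  let ?B = "\<lambda>i::nat. ball (undefined :: 'a) (real i + 1)"
  have "\<forall>i. \<exists>c. AE x in M. x \<in> ?B i \<longrightarrow> u x = c" by (intro allI assms) simp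
  then obtain c where "\<And>i. AE x in M. x \<in> ?B i \<longrightarrow> u x = c i" by metis
  then have AE: "AE x in M. \<forall>i. x \<in> ?B i \<longrightarrow> u x = c i" by (simp add: AE_all_countable)
  have "\<exists>x\<in>?B 0. \<forall>i. x \<in> ?B i \<longrightarrow> u x = c i"
  proof (rule ccontr)
    assume *: "\<not> ?thesis"
    have "AE x in M. x \<notin> ?B 0" using AE by eventually_elim (use * in blast)
    then have "emeasure M (?B 0) = 0"
      by (subst (asm) AE_iff_measurable[of "?B 0"]) (auto simp: space_M)
    then show False using emeasure_ball_pos[of 1 undefined] by simp
  qed
  then obtain x0 where x0: "x0 \<in> ?B 0" "\<And>i. x0 \<in> ?B i \<Longrightarrow> u x0 = c i" by blast
  have c0: "c i = c 0" for i using x0(2)[of i] x0(2)[of 0] x0(1) by auto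
  have "AE x in M. u x = c 0"
    using AE
  proof eventually_elim
    case (elim x)
    obtain i where "x \<in> ?B i" using UN_balls by blast
    with elim c0[of i] show ?case by simp
  qed
  then show ?thesis ..
qed

lemma AE_const_of_smoothings:
  assumes p: "1 < p" and poincare: "weak_poincare M p" and u: "integrable_on_balls M u"
    and approx: "\<And>\<epsilon>. 0 < \<epsilon> \<Longrightarrow> \<exists>r\<le>1. \<exists>P E. smoothing M C \<nu> u P p r E \<and> (\<integral>x. P x \<partial>M) \<le> \<epsilon> * r powr p"
  shows "\<exists>c. AE x in M. u x = c"
proof (rule AE_eq_const_of_balls)
  fix z and \<rho> :: real assume \<rho>: "0 < \<rho>"
  obtain Cp l where Cp: "Cp > 0" "l > 1" and
    poin: "\<And>v h x r. integrable_on_balls M v \<Longrightarrow> weak_upper_gradient M p v h \<Longrightarrow> r > 0 \<Longrightarrow>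
           ennreal (average M (ball x r) (\<lambda>y. \<bar>v y - average M (ball x r) v\<bar>))
             \<le> ennreal (Cp * r) *
               ennpowr ((\<integral>\<^sup>+y\<in>ball x (l * r). ennreal (h y powr p) \<partial>M)
                          / emeasure M (ball x (l * r))) (1 / p)"
    using poincare unfolding weak_poincare_def by blast
  define m m' where "m = measure M (ball z \<rho>)" and "m' = measure M (ball z (l * \<rho>))"
  have m: "m > 0" "m' > 0" unfolding m_def m'_def using \<rho> Cp by (auto intro!: measure_ball_pos)
  have K0: "K > 0" using K_ge_1 by simp
  have "AE x in M. x \<in> ball z \<rho> \<longrightarrow> u x = average M (ball z \<rho>) u"
  proof (rule AE_eq_const_on_ball[OF u \<rho>])
    fix \<eta> :: real assume \<eta>: "0 < \<eta>"
    \<comment> \<open>The target \<open>\<eta>\<close> is split into thirds; this makes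
      \<open>6 * K\<^sup>2 * (a * m)\<close> the first. It is fixed before
      \<open>\<epsilon>\<close>, as \<open>a powr (1 - p)\<close> grows when \<open>a\<close>
      shrinks.\<close>
    define a where "a = \<eta> / (18 * K\<^sup>2 * m)"
    have a: "a > 0" using \<eta> m K0 by (simp add: a_def)
    define X where "X = m * (Cp * \<rho> * (15 * K\<^sup>2))"
    have X: "X > 0" using m Cp \<rho> K0 by (simp add: X_def)
    \<comment> \<open>The first entry settles the other part of the mollification error, using
      \<open>r \<le> 1\<close>; the second settles the Poincare term, in which
      \<open>r powr p\<close> cancels.\<close>
    define \<epsilon> where "\<epsilon> = min (\<eta> / (18 * K\<^sup>2 * a powr (1 - p))) (m' / K * (\<eta> / (3 * X)) powr p)"
    have \<epsilon>: "\<epsilon> > 0" using \<eta> a m K0 X by (simp add: \<epsilon>_def)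
    obtain r P E where r1: "r \<le> 1" and sm: "smoothing M C \<nu> u P p r E"
      and I: "(\<integral>x. P x \<partial>M) \<le> \<epsilon> * r powr p" using approx[OF \<epsilon>] by blast
    interpret smoothing M C \<nu> u P p r E by (rule sm)
    have I0: "0 \<le> (\<integral>x. P x \<partial>M)" using P_nonneg by (simp add: integral_nonneg_AE)
    obtain c where c: "(LINT x:ball z \<rho>|M. \<bar>u x - c\<bar>) \<le>
        6 * K\<^sup>2 * (a * m + a powr (1 - p) * (\<integral>x. P x \<partial>M)) +
        m * (Cp * \<rho> * (15 * K\<^sup>2 * (K * (\<integral>x. P x \<partial>M) / (m' * r powr p)) powr (1 / p)))"
      using oscillation_le[OF Cp \<rho> poin[OF v_integrable_on_balls h_upper_gradient \<rho>] a]
      unfolding m_def m'_def by blast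
    have "6 * K\<^sup>2 * (a * m) = \<eta> / 3" using m K0 by (simp add: a_def field_simps)
    moreover have "6 * K\<^sup>2 * (a powr (1 - p) * (\<integral>x. P x \<partial>M)) \<le> \<eta> / 3"
    proof -
      have "r powr p \<le> 1" using r r1 p by (simp add: powr_le1)
      then have "\<epsilon> * r powr p \<le> \<epsilon>" using \<epsilon> by (simp add: mult_left_le)
      with I have "(\<integral>x. P x \<partial>M) \<le> \<eta> / (18 * K\<^sup>2 * a powr (1 - p))" by (simp add: \<epsilon>_def)
      then show ?thesis using K0 a by (simp add: field_simps)
    qed
    moreover have "m * (Cp * \<rho> * (15 * K\<^sup>2 * (K * (\<integral>x. P x \<partial>M) / (m' * r powr p)) powr (1 / p))) \<le> \<eta> / 3"
    proof -
      have rp: "r powr p > 0" using r by simp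
      have "K * (\<integral>x. P x \<partial>M) / (m' * r powr p) \<le> K * (\<epsilon> * r powr p) / (m' * r powr p)"
        using I K0 m rp by (intro divide_right_mono mult_left_mono) auto
      also have "\<dots> = K * \<epsilon> / m'" using rp by simp
      also have "\<dots> \<le> K * (m' / K * (\<eta> / (3 * X)) powr p) / m'"
        using K0 m by (intro divide_right_mono mult_left_mono) (auto simp: \<epsilon>_def)
      also have "\<dots> = (\<eta> / (3 * X)) powr p" using K0 m by simp
      finally have "(K * (\<integral>x. P x \<partial>M) / (m' * r powr p)) powr (1 / p) \<le> ((\<eta> / (3 * X)) powr p) powr (1 / p)"
        using I0 K0 m rp p by (intro powr_mono2) auto
      also have "\<dots> = \<eta> / (3 * X)" using p \<eta> X by (simp add: powr_powr)
      finally have "X * (K * (\<integral>x. P x \<partial>M) / (m' * r powr p)) powr (1 / p) \<le> X * (\<eta> / (3 * X))"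
        using X by (intro mult_left_mono) auto
      also have "\<dots> = \<eta> / 3" using X by simp
      finally show ?thesis by (simp add: X_def mult.assoc)
    qed
    ultimately have "(LINT x:ball z \<rho>|M. \<bar>u x - c\<bar>) \<le> \<eta>"
      using c by (simp add: distrib_left)
    then show "\<exists>c. (LINT x:ball z \<rho>|M. \<bar>u x - c\<bar>) \<le> \<eta>" ..
  qed
  then show "\<exists>c. AE x in M. x \<in> ball z \<rho> \<longrightarrow> u x = c" ..
qed

end

section \<open>From Hajlasz gradients to majorants\<close>

lemma ennpowr_measurable [measurable (raw)]:
  assumes [measurable]: "f \<in> borel_measurable M"
  shows "(\<lambda>x. ennpowr (f x) p) \<in> borel_measurable M"
  unfolding ennpowr_def by measurable

lemma ennpowr_less_top_iff: "ennpowr x p < top \<longleftrightarrow> x < top"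
  by (simp add: ennpowr_def less_top)

lemma ennreal_le_suminf: "f i \<le> (\<Sum>i. f i)" for f :: "nat \<Rightarrow> ennreal"
  using sum_le_suminf[of f "{i}"] by simp

text \<open>The least \<open>i\<close> with \<open>2 powi (- k) * (1 / 2) ^ i \<le> d\<close> is
  positive by the upper bound on \<open>d\<close>; the annulus sought is that of its
  predecessor.\<close>

lemma exists_dyadic_annulus:
  fixes d :: real
  assumes "0 < d" "d < 2 powi (- k)"
  shows "\<exists>i::nat. 2 powi (- (k + int i) - 1) \<le> d \<and> d < 2 powi (- (k + int i))"
proof -
  have powi: "(2::real) powi (- (k + int i)) = 2 powi (- k) * (1 / 2) ^ i" for i
    by (simp add: power_int_diff power_divide)
  have "\<exists>i::nat. 2 powi (- k) * (1 / 2) ^ i \<le> d"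
  proof -
    have "\<exists>i. (1 / 2 :: real) ^ i < d / 2 powi (- k)"
      by (rule real_arch_pow_inv) (use assms in auto)
    then show ?thesis by (auto simp: field_simps intro: less_imp_le)
  qed
  define i where "i = (LEAST i::nat. 2 powi (- k) * (1 / 2) ^ i \<le> d)"
  have i: "2 powi (- k) * (1 / 2) ^ i \<le> d"
    unfolding i_def by (rule LeastI_ex) fact
  have "i \<noteq> 0"
  proof
    assume "i = 0"
    with i assms show False by simp
  qed
  then obtain j where j: "i = Suc j" by (cases i) auto
  then have "\<not> 2 powi (- k) * (1 / 2) ^ j \<le> d"
    using not_less_Least[of j "\<lambda>i. 2 powi (- k) * (1 / 2) ^ i \<le> d"] by (simp add: i_def)
  moreover have "- (k + int j) - 1 = - (k + int i)" using j by simp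
  then have "2 powi (- (k + int j) - 1) = (2 powi (- k) * (1 / 2) ^ i :: real)"
    by (simp only: powi)
  ultimately show ?thesis using i powi[of j] by (intro exI[of _ j]) auto
qed

text \<open>
  \<open>P\<close> is the sum of \<open>(2^(-j) g j)^p\<close> over \<open>j \<ge> k\<close>: it dominates every single term, and
  its integral is computed termwise without Minkowski's inequality.
\<close>

lemma (in doubling_mms) hajlasz_majorant:
  assumes p: "1 < p" and g: "g \<in> hajlasz_gradients M 1 u"
    and b: "0 \<le> b" "\<And>j. k \<le> j \<Longrightarrow> (\<integral>\<^sup>+x. ennreal (g j x powr p) \<partial>M) \<le> ennreal b"
  shows "\<exists>P E. (\<forall>x. 0 \<le> P x) \<and> integrable M P \<and> E \<in> null_sets M \<and>
    (\<integral>x. P x \<partial>M) \<le> 2 * b * (2 powi (- k)) powr p \<and>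
    (\<forall>x y. x \<notin> E \<longrightarrow> y \<notin> E \<longrightarrow> dist x y < 2 powi (- k) \<longrightarrow>
      \<bar>u x - u y\<bar> \<le> P x powr (1 / p) + P y powr (1 / p))"
proof -
  from g obtain E where [measurable]: "\<And>k. g k \<in> borel_measurable M" and g0: "\<And>k x. 0 \<le> g k x"
    and E: "E \<in> null_sets M" and
    bound: "\<And>k x y. x \<notin> E \<Longrightarrow> y \<notin> E \<Longrightarrow> 2 powi (- k - 1) \<le> dist x y \<Longrightarrow> dist x y < 2 powi (- k) \<Longrightarrow>
            \<bar>u x - u y\<bar> \<le> dist x y powr 1 * (g k x + g k y)"
    unfolding hajlasz_gradients_def by blast
  define \<delta> :: "nat \<Rightarrow> real" where "\<delta> i = 2 powi (- (k + int i))" for i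
  have \<delta>0: "0 < \<delta> i" for i by (simp add: \<delta>_def)
  have \<delta>_eq: "\<delta> i = \<delta> 0 * (1 / 2) ^ i" for i
    by (simp add: \<delta>_def power_int_diff power_divide)
  define T where "T x = (\<Sum>i. ennreal ((\<delta> i * g (k + int i) x) powr p))" for x
  have [measurable]: "T \<in> borel_measurable M" unfolding T_def[abs_def] by measurable
  define B where "B = \<delta> 0 powr p * b"
  have B: "0 \<le> B" using b by (simp add: B_def)
  have "(\<integral>\<^sup>+x. T x \<partial>M) = (\<Sum>i. \<integral>\<^sup>+x. ennreal ((\<delta> i * g (k + int i) x) powr p) \<partial>M)"
    unfolding T_def by (rule nn_integral_suminf) measurable
  also have "\<dots> \<le> (\<Sum>i. ennreal (B * (1 / 2) ^ i))"
  proof (intro suminf_le allI summableI)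
    fix i
    have "(\<integral>\<^sup>+x. ennreal ((\<delta> i * g (k + int i) x) powr p) \<partial>M) =
        (\<integral>\<^sup>+x. ennreal (\<delta> i powr p) * ennreal (g (k + int i) x powr p) \<partial>M)"
      using \<delta>0[of i] g0 by (intro nn_integral_cong) (simp add: powr_mult ennreal_mult)
    also have "\<dots> = ennreal (\<delta> i powr p) * (\<integral>\<^sup>+x. ennreal (g (k + int i) x powr p) \<partial>M)"
      by (rule nn_integral_cmult) measurable
    also have "\<dots> \<le> ennreal (\<delta> i powr p) * ennreal b"
      by (intro mult_left_mono b(2)) auto
    also have "\<dots> = ennreal (\<delta> i powr p * b)" using b by (simp add: ennreal_mult)
    also have "\<dots> \<le> ennreal (B * (1 / 2) ^ i)"
    proof (rule ennreal_leI)
      \<comment> \<open>As \<open>p > 1\<close>, the ratio may be enlarged to \<open>1 / 2\<close>;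
        the geometric series then sums to 2, the factor in front of \<open>b\<close>.\<close>
      have "((1 / 2 :: real) ^ i) powr p \<le> ((1 / 2) ^ i) powr 1"
        using p by (intro powr_mono') (auto simp: power_le_one)
      then have "((1 / 2 :: real) ^ i) powr p \<le> (1 / 2) ^ i" by simp
      then have "\<delta> 0 powr p * b * ((1 / 2) ^ i) powr p \<le> \<delta> 0 powr p * b * (1 / 2) ^ i"
        using b by (intro mult_left_mono) auto
      then show "\<delta> i powr p * b \<le> B * (1 / 2) ^ i"
        unfolding \<delta>_eq[of i] B_def using \<delta>0[of 0] by (simp add: powr_mult mult_ac)
    qed
    finally show "(\<integral>\<^sup>+x. ennreal ((\<delta> i * g (k + int i) x) powr p) \<partial>M) \<le> ennreal (B * (1 / 2) ^ i)" .
  qed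
  also have "\<dots> = ennreal (B * 2)"
  proof (rule suminf_ennreal_eq)
    show "(\<lambda>i. B * (1 / 2) ^ i) sums (B * 2)"
      using geometric_sums[of "1 / 2 :: real"] by (intro sums_mult) simp
  qed (use B in auto)
  finally have T_int: "(\<integral>\<^sup>+x. T x \<partial>M) \<le> ennreal (B * 2)" .
  have "(\<integral>\<^sup>+x. T x \<partial>M) \<noteq> \<infinity>" using T_int by (auto simp: top_unique)
  then have "AE x in M. T x \<noteq> \<infinity>" by (intro nn_integral_PInf_AE) auto
  then obtain E' where "\<And>x. x \<in> space M - E' \<Longrightarrow> T x \<noteq> \<infinity>" "E' \<in> null_sets M"
    by (rule AE_E3) blast
  then have E': "E' \<in> null_sets M" "\<And>x. x \<notin> E' \<Longrightarrow> T x \<noteq> \<infinity>" by (auto simp: space_M)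
  \<comment> \<open>Where \<open>T\<close> is infinite, \<open>enn2real\<close> returns 0 and the
    domination may fail; these points lie in the null set \<open>E'\<close>, which joins the
    exceptional set.\<close>
  define P where "P x = enn2real (T x)" for x
  have [measurable]: "P \<in> borel_measurable M" unfolding P_def[abs_def] by measurable
  have P0: "0 \<le> P x" for x by (simp add: P_def)
  have "(\<integral>\<^sup>+x. ennreal (P x) \<partial>M) \<le> (\<integral>\<^sup>+x. T x \<partial>M)"
    by (intro nn_integral_mono) (simp add: P_def ennreal_enn2real_if)
  then have le: "(\<integral>\<^sup>+x. ennreal (P x) \<partial>M) \<le> ennreal (B * 2)" using T_int by (rule order_trans)
  have P: "integrable M P"
    by (rule integrableI_nonneg) (use le P0 in \<open>auto intro: le_less_trans simp: less_top\<close>)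
  have "ennreal (\<integral>x. P x \<partial>M) \<le> ennreal (B * 2)"
    using nn_integral_eq_integral[OF P] P0 le by simp
  then have P_le: "(\<integral>x. P x \<partial>M) \<le> B * 2" using B by (simp add: ennreal_le_iff)
  have step: "\<delta> i * g (k + int i) x \<le> P x powr (1 / p)" if "x \<notin> E'" for i x
  proof -
    have "ennreal ((\<delta> i * g (k + int i) x) powr p) \<le> T x"
      unfolding T_def by (rule ennreal_le_suminf)
    then have "(\<delta> i * g (k + int i) x) powr p \<le> P x"
      using E'(2)[OF that] enn2real_mono[of "ennreal ((\<delta> i * g (k + int i) x) powr p)" "T x"]
      by (simp add: P_def less_top)
    then have "((\<delta> i * g (k + int i) x) powr p) powr (1 / p) \<le> P x powr (1 / p)"
      using p by (intro powr_mono2) auto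
    then show ?thesis using p \<delta>0[of i] g0[of "k + int i" x] by (simp add: powr_powr)
  qed
  show ?thesis
  proof (intro exI[of _ P] exI[of _ "E \<union> E'"] conjI allI impI P0 P)
    show "E \<union> E' \<in> null_sets M" using E E'(1) by (rule null_sets.Un)
    show "(\<integral>x. P x \<partial>M) \<le> 2 * b * (2 powi (- k)) powr p" using P_le by (simp add: B_def \<delta>_def mult_ac)
    fix x y assume xy: "x \<notin> E \<union> E'" "y \<notin> E \<union> E'" "dist x y < 2 powi - k"
    show "\<bar>u x - u y\<bar> \<le> P x powr (1 / p) + P y powr (1 / p)"
    proof (cases "x = y")
      case False
      then obtain i where i: "2 powi (- (k + int i) - 1) \<le> dist x y" "dist x y < \<delta> i"
        using exists_dyadic_annulus[of "dist x y" k] xy(3) by (auto simp: \<delta>_def)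
      have "\<bar>u x - u y\<bar> \<le> dist x y powr 1 * (g (k + int i) x + g (k + int i) y)"
        using xy i by (intro bound) (auto simp: \<delta>_def)
      also have "\<dots> \<le> \<delta> i * (g (k + int i) x + g (k + int i) y)"
        using i g0 by (intro mult_right_mono) auto
      also have "\<dots> \<le> P x powr (1 / p) + P y powr (1 / p)"
        using step[of x i] step[of y i] xy by (simp add: distrib_left)
      finally show ?thesis .
    qed simp
  qed
qed

section \<open>Applying the majorants at coarse and fine scales\<close>

context doubling_mms
begin

text \<open>A ball has positive measure, so it contains a point \<open>y0\<close> off
  \<open>E\<close>; on the ball \<open>u\<close> differs from \<open>u y0\<close> by an integrable
  amount. The scale \<open>2 * \<rho>\<close> covers the diameter.\<close>

lemma integrable_on_balls_of_majorants:
  assumes p: "1 < p" and [measurable]: "u \<in> borel_measurable M"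
    and maj: "\<And>R. 0 < R \<Longrightarrow> \<exists>P E. (\<forall>x. 0 \<le> P x) \<and> integrable M P \<and> E \<in> null_sets M \<and>
      (\<forall>x y. x \<notin> E \<longrightarrow> y \<notin> E \<longrightarrow> dist x y < R \<longrightarrow> \<bar>u x - u y\<bar> \<le> P x powr (1 / p) + P y powr (1 / p))"
  shows "integrable_on_balls M u"
  unfolding integrable_on_balls_def
proof (intro conjI allI impI)
  fix z and \<rho> :: real assume \<rho>: "0 < \<rho>"
  then obtain P E where P: "\<And>x. 0 \<le> P x" "integrable M P" and E: "E \<in> null_sets M"
    and bound: "\<And>x y. x \<notin> E \<Longrightarrow> y \<notin> E \<Longrightarrow> dist x y < 2 * \<rho> \<Longrightarrow> \<bar>u x - u y\<bar> \<le> P x powr (1 / p) + P y powr (1 / p)"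
    using maj[of "2 * \<rho>"] by auto blast
  have "\<exists>y0. y0 \<in> ball z \<rho> - E"
  proof (rule ccontr)
    assume "\<not> ?thesis"
    then have "ball z \<rho> \<subseteq> E" by auto
    then have "ball z \<rho> \<in> null_sets M" by (rule null_sets_subset[OF E ball_sets_M])
    then show False using emeasure_ball_pos[OF \<rho>, of z] by (simp add: null_sets_def)
  qed
  then obtain y0 where y0: "y0 \<in> ball z \<rho>" "y0 \<notin> E" by blast
  \<comment> \<open>The final 1 comes from \<open>powr_inverse_le_add\<close> with
    \<open>a = 1\<close>, which bounds \<open>P y powr (1 / p)\<close> by
    \<open>1 + P y\<close>.\<close>
  define c where "c = \<bar>u y0\<bar> + P y0 powr (1 / p) + 1"
  show "set_integrable M (ball z \<rho>) u"
  proof (rule set_integral_abs_le(1))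
    show "set_integrable M (ball z \<rho>) (\<lambda>y. c + P y)"
      by (intro set_integral_add(1) set_integrable_const_ball set_integrable_ball_of_integrable P)
    show "AE y\<in>ball z \<rho> in M. \<bar>u y\<bar> \<le> c + P y"
      using AE_not_in[OF E]
    proof eventually_elim
      case (elim y)
      show ?case
      proof
        assume "y \<in> ball z \<rho>"
        then have "dist y y0 < 2 * \<rho>" using y0(1) dist_triangle[of y y0 z] by (simp add: dist_commute)
        from bound[OF elim y0(2) this] powr_inverse_le_add[OF p P(1), of 1 y]
        show "\<bar>u y\<bar> \<le> c + P y" by (simp add: c_def)
      qed
    qed
  qed measurable
qed measurable

text \<open>Coarse scales give integrability of \<open>u\<close> on large balls, for which bounded
  norms suffice; fine scales give the smoothings, for which the norms must tend to 0.\<close>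

lemma AE_const_of_hajlasz_gradient:
  assumes p: "1 < p" and poincare: "weak_poincare M p" and u: "u \<in> borel_measurable M"
    and g: "g \<in> hajlasz_gradients M 1 u"
    and fin: "\<And>k. (\<integral>\<^sup>+x. ennreal (g k x powr p) \<partial>M) < top"
    and lim: "(\<lambda>k::nat. \<integral>\<^sup>+x. ennreal (g (int k) x powr p) \<partial>M) \<longlonglongrightarrow> 0"
  shows "\<exists>c. AE x in M. u x = c"
proof -
  define a where "a k = (\<integral>\<^sup>+x. ennreal (g k x powr p) \<partial>M)" for k
  have ev: "\<exists>N. \<forall>j\<ge>int N. a j \<le> ennreal e" if "0 < e" for e
  proof -
    have "eventually (\<lambda>k. a (int k) < ennreal e) sequentially"
      using lim that unfolding a_def by (intro order_tendstoD(2)) auto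
    then obtain N where "\<And>k. k \<ge> N \<Longrightarrow> a (int k) < ennreal e" by (auto simp: eventually_sequentially)
    then have "a j \<le> ennreal e" if "j \<ge> int N" for j
      using that by (metis less_imp_le nonneg_int_cases of_nat_0_le_iff of_nat_le_iff order_trans)
    then show ?thesis by blast
  qed
  have bdd: "\<exists>b\<ge>0. \<forall>j\<ge>k. a j \<le> ennreal b" for k
  proof -
    obtain N where N: "\<And>j. j \<ge> int N \<Longrightarrow> a j \<le> ennreal 1" using ev[of 1] by auto
    \<comment> \<open>The 1 bounds the tail from \<open>N\<close> on, the sum bounds the finitely
      many indices before it.\<close>
    define b where "b = 1 + (\<Sum>j\<in>{k..int N}. enn2real (a j))"
    have "a j \<le> ennreal b" if "j \<ge> k" for j
    proof (cases "j \<ge> int N")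
      case True
      have "ennreal 1 \<le> ennreal b" unfolding b_def by (intro ennreal_leI) (simp add: sum_nonneg)
      with N[OF True] show ?thesis by (rule order_trans)
    next
      case False
      have "a j = ennreal (enn2real (a j))" using fin[of j] by (simp add: a_def)
      also have "enn2real (a j) \<le> b"
        unfolding b_def using that False by (intro add_increasing member_le_sum) auto
      finally show ?thesis by (simp add: ennreal_leI)
    qed
    moreover have "b \<ge> 0" by (simp add: b_def sum_nonneg)
    ultimately show ?thesis by blast
  qed
  have ib: "integrable_on_balls M u"
  proof (rule integrable_on_balls_of_majorants[OF p u])
    fix R :: real assume "0 < R"
    \<comment> \<open>Large distances correspond to negative dyadic indices.\<close>
    obtain n where "R < 2 ^ n" using real_arch_pow[of 2 R] by auto
    then have R: "R < 2 powi (- (- int n))" by simp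
    obtain b where "b \<ge> 0" "\<forall>j\<ge>- int n. a j \<le> ennreal b" using bdd by blast
    from hajlasz_majorant[OF p g, of b "- int n"] this
    obtain P E where "\<forall>x. 0 \<le> P x" "integrable M P" "E \<in> null_sets M"
      "\<And>x y. x \<notin> E \<Longrightarrow> y \<notin> E \<Longrightarrow> dist x y < 2 powi (- (- int n)) \<Longrightarrow>
        \<bar>u x - u y\<bar> \<le> P x powr (1 / p) + P y powr (1 / p)" unfolding a_def by blast
    then show "\<exists>P E. (\<forall>x. 0 \<le> P x) \<and> integrable M P \<and> E \<in> null_sets M \<and>
      (\<forall>x y. x \<notin> E \<longrightarrow> y \<notin> E \<longrightarrow> dist x y < R \<longrightarrow> \<bar>u x - u y\<bar> \<le> P x powr (1 / p) + P y powr (1 / p))"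
      using R by (meson less_trans)
  qed
  show ?thesis
  proof (rule AE_const_of_smoothings[OF p poincare ib])
    fix \<epsilon> :: real assume \<epsilon>: "0 < \<epsilon>"
    \<comment> \<open>Compensates the factor 2 of \<open>hajlasz_majorant\<close> and the 6 between
      \<open>r\<close> and the dyadic scale:
      \<open>2 * b * (6 * r) powr p = \<epsilon> * r powr p\<close>.\<close>
    define b where "b = \<epsilon> / (2 * 6 powr p)"
    have b: "b > 0" using \<epsilon> by (simp add: b_def)
    obtain N where N: "\<And>j. j \<ge> int N \<Longrightarrow> a j \<le> ennreal b" using ev[OF b] by auto
    from hajlasz_majorant[OF p g less_imp_le[OF b] N[unfolded a_def]]
    obtain P E where P: "\<And>x. 0 \<le> P x" "integrable M P" "E \<in> null_sets M"
      "\<And>x y. x \<notin> E \<Longrightarrow> y \<notin> E \<Longrightarrow> dist x y < 2 powi (- int N) \<Longrightarrow>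
        \<bar>u x - u y\<bar> \<le> P x powr (1 / p) + P y powr (1 / p)"
      "(\<integral>x. P x \<partial>M) \<le> 2 * b * (2 powi (- int N)) powr p"
      by blast
    define r :: real where "r = 2 powi (- int N) / 6"
    have r: "0 < r" "6 * r = 2 powi (- int N)" by (auto simp: r_def)
    have "smoothing M C \<nu> u P p r E"
      by unfold_locales (use p r P ib in auto)
    moreover have "r \<le> 1"
    proof -
      have "(2::real) powi (- int N) \<le> 1" by (simp add: power_int_minus inverse_le_1_iff)
      then show ?thesis by (simp add: r_def)
    qed
    moreover have "(\<integral>x. P x \<partial>M) \<le> \<epsilon> * r powr p"
    proof -
      have "2 * b * (6 * r) powr p = \<epsilon> * r powr p" using r(1) by (simp add: b_def powr_mult)
      then show ?thesis using P(5) r(2) by simp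
    qed
    ultimately show "\<exists>r\<le>1. \<exists>P E. smoothing M C \<nu> u P p r E \<and> (\<integral>x. P x \<partial>M) \<le> \<epsilon> * r powr p" by blast
  qed
qed

end

section \<open>Extracting gradients with vanishing norms\<close>

lemma ennreal_tendsto_0_of_nn_integral_int:
  assumes "(\<integral>\<^sup>+k. f k \<partial>count_space (UNIV :: int set)) < top"
  shows "(\<lambda>k::nat. f (int k)) \<longlonglongrightarrow> 0"
proof -
  have "(\<Sum>k. f (int k)) = (\<integral>\<^sup>+k. f k \<partial>count_space (range int))"
    unfolding nn_integral_count_space_nat[symmetric]
    by (rule nn_integral_bij_count_space) (simp add: bij_betw_def)
  also have "\<dots> \<le> (\<integral>\<^sup>+k. f k \<partial>count_space UNIV)"
    by (subst nn_integral_count_space_indicator) (auto intro!: nn_integral_mono split: split_indicator)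
  finally have fin: "(\<Sum>k. f (int k)) < top" using assms by (rule le_less_trans)
  then have "f (int k) < top" for k
    using le_less_trans[OF ennreal_le_suminf[of "\<lambda>k. f (int k)" k]] by simp
  then have eq: "f (int k) = ennreal (enn2real (f (int k)))" for k by simp
  have "summable (\<lambda>k. enn2real (f (int k)))"
    by (rule summable_suminf_not_top) (use fin eq in auto)
  then have "(\<lambda>k. enn2real (f (int k))) \<longlonglongrightarrow> 0" by (rule summable_LIMSEQ_zero)
  then have "(\<lambda>k. ennreal (enn2real (f (int k)))) \<longlonglongrightarrow> ennreal 0" by (rule tendsto_ennrealI)
  then show ?thesis using eq by simp
qed

lemma tendsto_enn2real_powr_0:
  assumes "(\<lambda>k. ennpowr (f k) s) \<longlonglongrightarrow> 0" "\<And>k. f k < top" "0 < s" "0 < t"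
  shows "(\<lambda>k::nat. ennpowr (f k) t) \<longlonglongrightarrow> 0"
proof -
  have eq: "ennpowr (f k) e = ennreal (enn2real (f k) powr e)" for k e
    using assms(2)[of k] by (simp add: ennpowr_def)
  have "(\<lambda>k. enn2real (f k) powr s) \<longlonglongrightarrow> 0"
    using assms(1) unfolding eq by (simp add: ennreal_tendsto_0_iff)
  then have "(\<lambda>k. (enn2real (f k) powr s) powr (t / s)) \<longlonglongrightarrow> 0"
    by (rule tendsto_zero_powrI[OF _ tendsto_const]) (use assms in auto)
  then have "(\<lambda>k. enn2real (f k) powr t) \<longlonglongrightarrow> 0" using assms(3) by (simp add: powr_powr)
  then show ?thesis unfolding eq by (simp add: ennreal_tendsto_0_iff)
qed

section \<open>The two function spaces\<close>

lemma doubling_mms_exists: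
  assumes "doubling_metric_measure_space M"
  shows "\<exists>C \<nu>. doubling_mms M C \<nu>"
proof -
  from assms obtain C n where "1 < C" "0 < n" "\<And>x r l. 0 < r \<Longrightarrow> 1 < l \<Longrightarrow>
      emeasure M (ball x (l * r)) \<le> ennreal (C * l powr n) * emeasure M (ball x r)"
    unfolding doubling_metric_measure_space_def doubling_def by blast
  then have "doubling_mms M C n"
    using assms by unfold_locales (auto simp: doubling_metric_measure_space_def borel_regular_def)
  then show ?thesis by blast
qed

text \<open>The terms of the convergent series of \<open>ennpowr (a k) (q / p)\<close> tend to 0,
  and changing the exponent from \<open>q / p\<close> to 1 preserves this.\<close>

lemma N_space_gradient:
  assumes p: "0 < p" and q: "0 < q" and u: "u \<in> N_space M s p (ennreal q)"
  shows "\<exists>g\<in>hajlasz_gradients M s u. (\<forall>k. (\<integral>\<^sup>+x. ennreal (g k x powr p) \<partial>M) < top) \<and>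
    (\<lambda>k::nat. \<integral>\<^sup>+x. ennreal (g (int k) x powr p) \<partial>M) \<longlonglongrightarrow> 0"
proof -
  from u obtain g where g: "g \<in> hajlasz_gradients M s u"
    and fin: "lq_norm (ennreal q) (\<lambda>k. Lp_norm M p (\<lambda>x. ennreal (g k x))) < top"
    by (auto simp: N_space_def INF_less_iff)
  have g0: "0 \<le> g k x" for k x using g by (simp add: hajlasz_gradients_def)
  define a where "a k = (\<integral>\<^sup>+x. ennreal (g k x powr p) \<partial>M)" for k
  have "(\<integral>\<^sup>+k. ennpowr (ennpowr (a k) (1 / p)) q \<partial>count_space UNIV) < top"
    using fin q g0 by (simp add: lq_norm_def Lp_norm_def a_def ennpowr_ennreal ennpowr_less_top_iff)
  moreover have "ennpowr (ennpowr (a k) (1 / p)) q = ennpowr (a k) (q / p)" for k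
    by (simp add: ennpowr_def powr_powr)
  ultimately have fin': "(\<integral>\<^sup>+k. ennpowr (a k) (q / p) \<partial>count_space UNIV) < top" by simp
  have a_fin: "a k < top" for k
  proof -
    have "ennpowr (a k) (q / p) \<le> (\<integral>\<^sup>+k. ennpowr (a k) (q / p) \<partial>count_space UNIV)"
      by (rule nn_integral_ge_point) simp
    then have "ennpowr (a k) (q / p) < top" using fin' by (rule le_less_trans)
    then show ?thesis by (simp only: ennpowr_less_top_iff)
  qed
  have "(\<lambda>k::nat. ennpowr (a (int k)) 1) \<longlonglongrightarrow> 0"
    by (rule tendsto_enn2real_powr_0[OF ennreal_tendsto_0_of_nn_integral_int[OF fin'] a_fin]) (use p q in auto)
  moreover have "ennpowr (a k) 1 = a k" for k using a_fin[of k] by (simp add: ennpowr_def)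
  ultimately show ?thesis using g a_fin unfolding a_def by auto
qed

text \<open>Here the series over \<open>k\<close> converges pointwise almost everywhere, so
  \<open>g k x\<close> tends to 0 for almost every \<open>x\<close>; dominated convergence carries
  this over to the integrals.\<close>

lemma M_space_gradient:
  assumes p: "0 < p" and q: "0 < q" and u: "u \<in> M_space M s p (ennreal q)"
  shows "\<exists>g\<in>hajlasz_gradients M s u. (\<forall>k. (\<integral>\<^sup>+x. ennreal (g k x powr p) \<partial>M) < top) \<and>
    (\<lambda>k::nat. \<integral>\<^sup>+x. ennreal (g (int k) x powr p) \<partial>M) \<longlonglongrightarrow> 0"
proof -
  from u obtain g where g: "g \<in> hajlasz_gradients M s u"
    and fin: "Lp_norm M p (\<lambda>x. lq_norm (ennreal q) (\<lambda>k. ennreal (g k x))) < top"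
    by (auto simp: M_space_def INF_less_iff)
  have g0: "0 \<le> g k x" and [measurable]: "g k \<in> borel_measurable M" for k x
    using g by (auto simp: hajlasz_gradients_def)
  define F where "F x = ennpowr (\<integral>\<^sup>+k. ennreal (g k x powr q) \<partial>count_space UNIV) (p / q)" for x
  have *: "ennpowr (ennpowr x (1 / q)) p = ennpowr x (p / q)" for x
    by (simp add: ennpowr_def powr_powr)
  have fin': "(\<integral>\<^sup>+x. F x \<partial>M) < top"
    using fin q g0 by (simp add: lq_norm_def Lp_norm_def F_def ennpowr_ennreal ennpowr_less_top_iff *)
  have le: "ennreal (g k x powr p) \<le> ennpowr y (p / q)" if "ennreal (g k x powr q) \<le> y" for k x y
    using ennpowr_mono[OF that, of "p / q"] p q g0[of k x] by (simp add: ennpowr_ennreal powr_powr)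
  have a_fin: "(\<integral>\<^sup>+x. ennreal (g k x powr p) \<partial>M) < top" for k
  proof -
    have "ennreal (g k x powr p) \<le> F x" for x
      unfolding F_def by (rule le, rule nn_integral_ge_point) simp
    then have "(\<integral>\<^sup>+x. ennreal (g k x powr p) \<partial>M) \<le> (\<integral>\<^sup>+x. F x \<partial>M)" by (rule nn_integral_mono)
    then show ?thesis using fin' by (rule le_less_trans)
  qed
  \<comment> \<open>The part of the sum over nonnegative indices, written as a series so that
    measurability is immediate; a power of it is the dominating function.\<close>
  define G where "G x = (\<Sum>k. ennreal (g (int k) x powr q))" for x
  have [measurable]: "G \<in> borel_measurable M" unfolding G_def[abs_def] by measurable
  have GF: "ennpowr (G x) (p / q) \<le> F x" for x
    unfolding F_def
  proof (rule ennpowr_mono)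
    have "G x = (\<integral>\<^sup>+k. ennreal (g k x powr q) \<partial>count_space (range int))"
      unfolding G_def nn_integral_count_space_nat[symmetric]
      by (rule nn_integral_bij_count_space) (simp add: bij_betw_def)
    also have "\<dots> \<le> (\<integral>\<^sup>+k. ennreal (g k x powr q) \<partial>count_space UNIV)"
      by (subst nn_integral_count_space_indicator) (auto intro!: nn_integral_mono split: split_indicator)
    finally show "G x \<le> (\<integral>\<^sup>+k. ennreal (g k x powr q) \<partial>count_space UNIV)" .
  qed (use p q in auto)
  have "(\<integral>\<^sup>+x. ennpowr (G x) (p / q) \<partial>M) \<le> (\<integral>\<^sup>+x. F x \<partial>M)"
    by (intro nn_integral_mono GF)
  then have G_fin: "(\<integral>\<^sup>+x. ennpowr (G x) (p / q) \<partial>M) < \<infinity>" using fin' by (simp add: le_less_trans)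
  have "AE x in M. ennpowr (G x) (p / q) \<noteq> \<infinity>"
    by (rule nn_integral_PInf_AE) (use G_fin in auto)
  then have lim: "AE x in M. (\<lambda>k. ennreal (g (int k) x powr p)) \<longlonglongrightarrow> 0"
  proof eventually_elim
    case (elim x)
    then have "G x \<noteq> top" by (auto simp: ennpowr_def)
    then have "summable (\<lambda>k. g (int k) x powr q)"
      unfolding G_def by (intro summable_suminf_not_top) auto
    then have "(\<lambda>k. g (int k) x powr q) \<longlonglongrightarrow> 0" by (rule summable_LIMSEQ_zero)
    then have "(\<lambda>k. (g (int k) x powr q) powr (p / q)) \<longlonglongrightarrow> 0"
      by (rule tendsto_zero_powrI[OF _ tendsto_const]) (use p q in auto)
    then have "(\<lambda>k. g (int k) x powr p) \<longlonglongrightarrow> 0" using q by (simp add: powr_powr)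
    then show ?case by (simp add: ennreal_tendsto_0_iff)
  qed
  have leG: "ennreal (g (int k) x powr q) \<le> G x" for k x
    unfolding G_def by (rule ennreal_le_suminf)
  have dom: "ennreal (g (int k) x powr p) \<le> ennpowr (G x) (p / q)" for k x
    by (rule le[OF leG])
  have m1: "(\<lambda>x. ennreal (g (int k) x powr p)) \<in> borel_measurable M" for k by measurable
  have m2: "(\<lambda>x. ennpowr (G x) (p / q)) \<in> borel_measurable M" by measurable
  have "(\<lambda>k. \<integral>\<^sup>+x. ennreal (g (int k) x powr p) \<partial>M) \<longlonglongrightarrow> (\<integral>\<^sup>+x. 0 \<partial>M)"
    by (rule nn_integral_dominated_convergence[OF m1 _ m2 AE_I2[OF dom] G_fin lim]) simp
  then show ?thesis using g a_fin by auto
qed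

theorem theorem4p1:
  fixes M :: "'a::metric_space measure" and p :: real
  assumes "doubling_metric_measure_space M"
    and "1 < p"
    and "weak_poincare M p"
  shows "\<forall>q::real. 0 < q \<longrightarrow>
    (\<forall>u\<in>N_space M 1 p (ennreal q). \<exists>c. AE x in M. u x = c) \<and>
    (\<forall>u\<in>M_space M 1 p (ennreal q). \<exists>c. AE x in M. u x = c)"
proof -
  obtain C \<nu> where "doubling_mms M C \<nu>" using doubling_mms_exists[OF assms(1)] by blast
  then interpret doubling_mms M C \<nu> .
  have p: "0 < p" using assms(2) by simp
  have "\<exists>c. AE x in M. u x = c" if "0 < q" "u \<in> N_space M 1 p (ennreal q)" for q u
    using N_space_gradient[OF p that] AE_const_of_hajlasz_gradient[OF assms(2,3)] that(2)
    by (auto simp: N_space_def)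
  moreover have "\<exists>c. AE x in M. u x = c" if "0 < q" "u \<in> M_space M 1 p (ennreal q)" for q u
    using M_space_gradient[OF p that] AE_const_of_hajlasz_gradient[OF assms(2,3)] that(2)
    by (auto simp: M_space_def)
  ultimately show ?thesis by blast
qed

end
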